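(* Let $\mathcal{X}$ be a connected Kobayashi hyperbolic complex manifold equipped with the Kobayashi distance $\mathsf{k}_{\mathcal{X}}$ (no completeness of $\mathsf{k}_{\mathcal X}$ is assumed). Let $\overline{\mathcal{X}}^{\mathsf{k}}$ denote the metric compactification of the metric space $(\mathcal{X},\mathsf{k}_{\mathcal{X}})$ and $i_{\mathsf{k}}:\mathcal{X}\to\overline{\mathcal{X}}^{\mathsf{k}}$ the canonical map. Then $(\overline{\mathcal{X}}^{\mathsf{k}}, i_{\mathsf{k}})$ is a compactification of $\mathcal{X}$; that is, $\overline{\mathcal{X}}^{\mathsf{k}}$ is a sequentially compact Hausdorff topological space, $i_{\mathsf{k}}$ is a homeomorphism onto its image, and $i_{\mathsf{k}}(\mathcal{X})$ is open and dense in $\overline{\mathcal{X}}^{\mathsf{k}}$.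
   Context: A complex manifold is Kobayashi hyperbolic if its Kobayashi pseudodistance is a genuine distance. Metric compactification of a metric space $(X,d)$: let $C(X)$ be the space of real-valued continuous functions on $X$ with the topology of local uniform convergence, and let $C_*(X)$ be the quotient of $C(X)$ by the subspace of constant functions, with the quotient topology; write $[f]=\{f+c: c\in\mathbb{R}\}$ for the class of $f$. Define $i_d:X\to C_*(X)$ by $i_d(x)=[d(x,\cdot)]$. The metric compactification $\overline{X}^d$ is the closure of $i_d(X)$ in $C_*(X)$. For $(\mathcal{X},\mathsf{k}_{\mathcal{X}})$ it is written $\overline{\mathcal{X}}^{\mathsf{k}}$, with canonical map $i_{\mathsf{k}}$. *)

theory Defs
  imports "HOL-Analysis.Analysis"
begin

section \<open>Complex manifolds\<close>

text \<open>
  Manifolds are modelled on a complex linear subspace \<open>E\<close> of \<open>\<complex>\<^sup>n\<close>, where \<open>n\<close> is the cardinality of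
  an index type; the manifold then has dimension \<^term>\<open>vec.dim E\<close>. Taking \<open>E\<close> to be the whole
  space gives the usual charts into \<open>\<complex>\<^sup>n\<close>; since index types are nonempty, the extra generality
  is what admits dimension zero.

  Holomorphic means complex differentiable: the Frechet derivative is complex linear,
  i.e. given by a complex Jacobian matrix. This is only applied to relatively open
  subsets \<open>S\<close> of \<open>E\<close>, where just the restriction of \<open>J\<close> to \<open>E\<close> is determined.
\<close>

definition holomorphic_map_on ::
    "(complex^'n \<Rightarrow> complex^'m) \<Rightarrow> (complex^'n) set \<Rightarrow> bool" where
  "holomorphic_map_on g S \<longleftrightarrow>
     (\<forall>z\<in>S. \<exists>J :: complex^'n^'m. (g has_derivative (\<lambda>v. J *v v)) (at z within S))"

definition is_chart ::
    "(complex^'n) set \<Rightarrow> 'a topology \<Rightarrow> 'a set \<Rightarrow> ('a \<Rightarrow> complex^'n) \<Rightarrow> bool" where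
  "is_chart E X U \<phi> \<longleftrightarrow>
     openin X U \<and> openin (top_of_set E) (\<phi> ` U) \<and>
     homeomorphic_map (subtopology X U) (top_of_set (\<phi> ` U)) \<phi>"

text \<open>The atlas \<open>\<A>\<close> is not required to be maximal.\<close>

definition complex_manifold ::
    "(complex^'n) set \<Rightarrow> 'a topology \<Rightarrow> ('a set \<times> ('a \<Rightarrow> complex^'n)) set \<Rightarrow> bool" where
  "complex_manifold E X \<A> \<longleftrightarrow>
     vec.subspace E \<and> Hausdorff_space X \<and> second_countable X \<and>
     (\<forall>(U, \<phi>)\<in>\<A>. is_chart E X U \<phi>) \<and>
     (\<Union>(U, \<phi>)\<in>\<A>. U) = topspace X \<and>
     (\<forall>(U, \<phi>)\<in>\<A>. \<forall>(V, \<psi>)\<in>\<A>.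
        holomorphic_map_on (\<psi> \<circ> inv_into U \<phi>) (\<phi> ` (U \<inter> V)))"


section \<open>The Kobayashi pseudodistance\<close>

definition holomorphic_disc ::
    "'a topology \<Rightarrow> ('a set \<times> ('a \<Rightarrow> complex^'n)) set \<Rightarrow> (complex \<Rightarrow> 'a) \<Rightarrow> bool" where
  "holomorphic_disc X \<A> f \<longleftrightarrow>
     continuous_map (top_of_set (ball 0 1)) X f \<and>
     (\<forall>(U, \<phi>)\<in>\<A>. \<forall>i. (\<lambda>z. \<phi> (f z) $ i) holomorphic_on {z \<in> ball 0 1. f z \<in> U})"

text \<open>The Poincare distance on the unit disc, normalised to curvature \<open>-4\<close>.\<close>

definition poincare_dist :: "complex \<Rightarrow> complex \<Rightarrow> real" where
  "poincare_dist a b = artanh (cmod ((a - b) / (1 - cnj b * a)))"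

text \<open>
  The infimum runs over chains \<open>x = p 0, \<dots>, p m = y\<close> of points with consecutive points joined by
  holomorphic discs. It is over a nonempty set whenever \<open>x\<close> and \<open>y\<close> lie in the same component;
  on a disconnected manifold the value \<open>+\<infinity>\<close> that one would want is not represented, so this
  is to be used for connected manifolds only. The value \<open>0\<close> outside the manifold is needed
  because \<^locale>\<open>Metric_space\<close> requires non-negativity and symmetry on the whole type.
\<close>

definition kobayashi_dist ::
    "'a topology \<Rightarrow> ('a set \<times> ('a \<Rightarrow> complex^'n)) set \<Rightarrow> 'a \<Rightarrow> 'a \<Rightarrow> real" where
  "kobayashi_dist X \<A> x y =
     (if x \<in> topspace X \<and> y \<in> topspace X
      then Inf {(\<Sum>j<m. poincare_dist (a j) (b j)) | (m::nat) p f a b.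
                  p 0 = x \<and> p m = y \<and>
                  (\<forall>j<m. holomorphic_disc X \<A> (f j) \<and> a j \<in> ball 0 1 \<and> b j \<in> ball 0 1 \<and>
                         f j (a j) = p j \<and> f j (b j) = p (Suc j))}
      else 0)"

definition kobayashi_hyperbolic ::
    "'a topology \<Rightarrow> ('a set \<times> ('a \<Rightarrow> complex^'n)) set \<Rightarrow> bool" where
  "kobayashi_hyperbolic X \<A> \<longleftrightarrow> Metric_space (topspace X) (kobayashi_dist X \<A>)"


section \<open>The metric compactification\<close>

text \<open>Functions on a space are represented by total functions that are \<open>undefined\<close> off it.\<close>

definition continuous_funs :: "'a topology \<Rightarrow> ('a \<Rightarrow> real) set" where
  "continuous_funs T = {f \<in> extensional (topspace T). continuous_map T euclideanreal f}"

definition locally_uniform_limit ::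
    "'a topology \<Rightarrow> ('a \<Rightarrow> real) \<Rightarrow> ('a \<Rightarrow> real) filter \<Rightarrow> bool" where
  "locally_uniform_limit T f F \<longleftrightarrow>
     (\<forall>x\<in>topspace T. \<exists>U. openin T U \<and> x \<in> U \<and> uniform_limit U (\<lambda>g. g) f F)"

text \<open>
  The topology of local uniform convergence on \<open>C(T)\<close>: the finest topology in which every locally
  uniformly convergent filter converges. For locally compact \<open>T\<close> this is the topology of uniform
  convergence on compact sets.
\<close>

definition openin_local_uniform :: "'a topology \<Rightarrow> ('a \<Rightarrow> real) set \<Rightarrow> bool" where
  "openin_local_uniform T W \<longleftrightarrow>
     W \<subseteq> continuous_funs T \<and>
     (\<forall>f\<in>W. \<forall>F. eventually (\<lambda>g. g \<in> continuous_funs T) F \<and> locally_uniform_limit T f F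
               \<longrightarrow> eventually (\<lambda>g. g \<in> W) F)"

lemma istopology_local_uniform: "istopology (openin_local_uniform T)"
  unfolding istopology_def
proof (intro conjI allI impI)
  fix S W assume "openin_local_uniform T S" "openin_local_uniform T W"
  then show "openin_local_uniform T (S \<inter> W)"
    unfolding openin_local_uniform_def by (auto simp: eventually_conj_iff)
next
  fix K assume K: "\<forall>W\<in>K. openin_local_uniform T W"
  show "openin_local_uniform T (\<Union>K)"
    unfolding openin_local_uniform_def
  proof (intro conjI ballI allI impI)
    show "\<Union>K \<subseteq> continuous_funs T"
      using K unfolding openin_local_uniform_def by blast
  next
    fix f F assume "f \<in> \<Union>K"
      and F: "eventually (\<lambda>g. g \<in> continuous_funs T) F \<and> locally_uniform_limit T f F"
    then obtain W where W: "W \<in> K" "f \<in> W" by blast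
    then have "eventually (\<lambda>g. g \<in> W) F"
      using K F unfolding openin_local_uniform_def by blast
    then show "eventually (\<lambda>g. g \<in> \<Union>K) F"
      by (rule eventually_mono) (use W in blast)
  qed
qed

definition local_uniform_topology :: "'a topology \<Rightarrow> ('a \<Rightarrow> real) topology" where
  "local_uniform_topology T = topology (openin_local_uniform T)"

lemma openin_local_uniform_topology [simp]:
  "openin (local_uniform_topology T) = openin_local_uniform T"
  by (simp add: local_uniform_topology_def istopology_local_uniform topology_inverse')

lemma topspace_local_uniform_topology [simp]:
  "topspace (local_uniform_topology T) = continuous_funs T"
proof -
  have "openin_local_uniform T (continuous_funs T)"
    by (auto simp: openin_local_uniform_def)
  then show ?thesis
    by (auto simp: topspace_def openin_local_uniform_def)
qed

text \<open>The class \<open>[f]\<close> of \<open>f\<close> modulo constants, and the quotient \<open>C\<^sub>*\<close> with the quotient topology.\<close>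

definition const_class :: "'a topology \<Rightarrow> ('a \<Rightarrow> real) \<Rightarrow> ('a \<Rightarrow> real) set" where
  "const_class T f = {restrict (\<lambda>x. f x + c) (topspace T) | c. True}"

definition quotient_topology :: "'b topology \<Rightarrow> ('b \<Rightarrow> 'c) \<Rightarrow> 'c topology" where
  "quotient_topology Y q =
     topology (\<lambda>W. W \<subseteq> q ` topspace Y \<and> openin Y {x \<in> topspace Y. q x \<in> W})"

lemma openin_quotient_topology:
  "openin (quotient_topology Y q) W \<longleftrightarrow>
     W \<subseteq> q ` topspace Y \<and> openin Y {x \<in> topspace Y. q x \<in> W}"
proof -
  have "istopology (\<lambda>W. W \<subseteq> q ` topspace Y \<and> openin Y {x \<in> topspace Y. q x \<in> W})"
    unfolding istopology_def
  proof (intro conjI allI impI)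
    fix S W
    assume "S \<subseteq> q ` topspace Y \<and> openin Y {x \<in> topspace Y. q x \<in> S}"
      and "W \<subseteq> q ` topspace Y \<and> openin Y {x \<in> topspace Y. q x \<in> W}"
    moreover have "{x \<in> topspace Y. q x \<in> S \<inter> W} =
        {x \<in> topspace Y. q x \<in> S} \<inter> {x \<in> topspace Y. q x \<in> W}" by blast
    ultimately show "S \<inter> W \<subseteq> q ` topspace Y" "openin Y {x \<in> topspace Y. q x \<in> S \<inter> W}"
      by auto
  next
    fix K assume K: "\<forall>W\<in>K. W \<subseteq> q ` topspace Y \<and> openin Y {x \<in> topspace Y. q x \<in> W}"
    then show "\<Union>K \<subseteq> q ` topspace Y" by blast
    have "{x \<in> topspace Y. q x \<in> \<Union>K} = (\<Union>W\<in>K. {x \<in> topspace Y. q x \<in> W})" by blast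
    then show "openin Y {x \<in> topspace Y. q x \<in> \<Union>K}"
      using K by auto
  qed
  then show ?thesis
    by (simp add: quotient_topology_def topology_inverse')
qed

lemma quotient_map_quotient_topology: "quotient_map Y (quotient_topology Y q) q"
proof -
  have "openin (quotient_topology Y q) (q ` topspace Y)"
    unfolding openin_quotient_topology
    by (smt (verit, best) Collect_cong Collect_mem_eq image_eqI openin_topspace order_refl)
  then have "topspace (quotient_topology Y q) = q ` topspace Y"
    by (meson openin_quotient_topology openin_subset openin_topspace subset_antisym)
  then show ?thesis
    by (auto simp: quotient_map_def openin_quotient_topology)
qed

definition funs_mod_const :: "'a topology \<Rightarrow> ('a \<Rightarrow> real) set topology" where
  "funs_mod_const T = quotient_topology (local_uniform_topology T) (const_class T)"

definition metric_embedding :: "'a set \<Rightarrow> ('a \<Rightarrow> 'a \<Rightarrow> real) \<Rightarrow> 'a \<Rightarrow> ('a \<Rightarrow> real) set" where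
  "metric_embedding M d x = const_class (Metric_space.mtopology M d) (restrict (d x) M)"

definition metric_compactification ::
    "'a set \<Rightarrow> ('a \<Rightarrow> 'a \<Rightarrow> real) \<Rightarrow> ('a \<Rightarrow> real) set topology" where
  "metric_compactification M d =
     (let C = funs_mod_const (Metric_space.mtopology M d)
      in subtopology C (C closure_of (metric_embedding M d ` M)))"


section \<open>Compactifications\<close>

definition seq_compact_space :: "'b topology \<Rightarrow> bool" where
  "seq_compact_space Y \<longleftrightarrow>
     (\<forall>\<sigma>::nat \<Rightarrow> 'b. range \<sigma> \<subseteq> topspace Y \<longrightarrow>
        (\<exists>l r. strict_mono r \<and> limitin Y (\<sigma> \<circ> r) l sequentially))"

definition is_compactification :: "'a topology \<Rightarrow> 'b topology \<Rightarrow> ('a \<Rightarrow> 'b) \<Rightarrow> bool" where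
  "is_compactification X Y i \<longleftrightarrow>
     seq_compact_space Y \<and> Hausdorff_space Y \<and>
     embedding_map X Y i \<and>
     openin Y (i ` topspace X) \<and> Y closure_of (i ` topspace X) = topspace Y"

end

theory Submission
  imports Defs "HOL-Complex_Analysis.Riemann_Mapping" "HOL-Complex_Analysis.Great_Picard"
begin

text \<open>
  The proof has a metric part and a complex analytic part, joined by one property of the Kobayashi
  distance: any two points \<open>x\<close>, \<open>y\<close> lie in a connected set on which \<open>d x z + d z y\<close> exceeds \<open>d x y\<close> by
  as little as desired. It takes the place of geodesics, which an incomplete space may lack.

  The metric part concerns a separable, locally compact metric space with this property. Points of its metric
  compactification are classes modulo constants of nonexpansive functions (\<open>increment_closure_le\<close>),
  so the Arzela--Ascoli argument gives sequential compactness, and the Hausdorff property holds because the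
  increments \<open>f y - f x\<close> are continuous and determine the class of \<open>f\<close>. The remaining
  claims all come from \<open>basic_nbhd_detects_ball\<close>: on a small compact ball around \<open>x\<close>,
  the distance function of a point outside the ball is not close to that of \<open>x\<close> modulo constants,
  since it decreases at nearly unit rate towards some point of the sphere while the distance from
  \<open>x\<close> increases. So if the class of \<open>d x'\<close> is close to that of \<open>d x\<close>,
  then \<open>x'\<close> is close to \<open>x\<close>, which makes the canonical map open onto its image; and
  near the class of \<open>d x\<close> the closure of the image involves only the image of a compact ball, which
  is already closed, so the image is open.

  The analytic part verifies the property. A chain of discs of almost minimal length is traced out
  in the manifold by images of Poincare geodesics, and along these the partial lengths add up exactly
  (\<open>connected_trace_of_chain\<close>). Affine discs in charts show that the Kobayashi distance is continuous
  and that chains exist on a connected manifold. Finally, the same property identifies the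
  topology of the Kobayashi distance with that of the manifold
  (\<open>near_geodesics_determine_topology\<close>), so that local compactness and separability can be read off
  the manifold.
\<close>

section \<open>Functions modulo constants\<close>

text \<open>
  The value does not depend on the representative, by \<open>increment_const_class\<close> below:
  increments are the coordinates in which classes modulo constants are compared. Choosing a base
  point \<open>x\<close>, the function \<open>increment c x\<close>, restricted to the space, is the
  representative of \<open>c\<close> that vanishes at \<open>x\<close>.
\<close>

definition increment :: "('a \<Rightarrow> real) set \<Rightarrow> 'a \<Rightarrow> 'a \<Rightarrow> real" where
  "increment c x y = (let f = (SOME f. f \<in> c) in f y - f x)"

lemma increment_const_class:
  assumes "x \<in> topspace T" "y \<in> topspace T"
  shows "increment (const_class T f) x y = f y - f x"
proof -
  have "restrict (\<lambda>x. f x + 0) (topspace T) \<in> const_class T f"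
    unfolding const_class_def by blast
  then have "(SOME h. h \<in> const_class T f) \<in> const_class T f"
    by (rule someI[of "\<lambda>h. h \<in> const_class T f"])
  then show ?thesis
    using assms by (auto simp: increment_def const_class_def Let_def)
qed

lemma const_class_eq:
  assumes f: "f \<in> continuous_funs T" and g: "g \<in> continuous_funs T"
    and eq: "\<And>x. x \<in> topspace T \<Longrightarrow> g x = f x + c"
  shows "const_class T f = const_class T g"
proof -
  have "restrict (\<lambda>x. f x + a) (topspace T) = restrict (\<lambda>x. g x + (a - c)) (topspace T)"
    "restrict (\<lambda>x. g x + a) (topspace T) = restrict (\<lambda>x. f x + (a + c)) (topspace T)" for a
    using eq by (auto simp: restrict_def)
  then show ?thesis
    unfolding const_class_def by blast
qed

lemma const_class_in_topspace:
  "f \<in> continuous_funs T \<Longrightarrow> const_class T f \<in> topspace (funs_mod_const T)"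
  using quotient_imp_surjective_map[OF quotient_map_quotient_topology[of "local_uniform_topology T" "const_class T"]]
  by (auto simp: funs_mod_const_def)

lemma topspace_funs_mod_const:
  "topspace (funs_mod_const T) = const_class T ` continuous_funs T"
  using quotient_imp_surjective_map[OF quotient_map_quotient_topology[of "local_uniform_topology T" "const_class T"]]
  by (simp add: funs_mod_const_def)

lemma increment_determines_class:
  assumes "c \<in> topspace (funs_mod_const T)" "c' \<in> topspace (funs_mod_const T)"
    and eq: "\<And>x y. x \<in> topspace T \<Longrightarrow> y \<in> topspace T \<Longrightarrow> increment c x y = increment c' x y"
  shows "c = c'"
proof -
  obtain f g where f: "f \<in> continuous_funs T" "c = const_class T f"
    and g: "g \<in> continuous_funs T" "c' = const_class T g"
    using assms(1,2) unfolding topspace_funs_mod_const by auto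
  show ?thesis
  proof (cases "topspace T = {}")
    case True
    then show ?thesis using const_class_eq[OF f(1) g(1), of 0] f(2) g(2) by blast
  next
    case False
    then obtain p where p: "p \<in> topspace T" by blast
    have "g x = f x + (g p - f p)" if "x \<in> topspace T" for x
      using eq[OF p that] p that by (simp add: f(2) g(2) increment_const_class)
    then show ?thesis using const_class_eq[OF f(1) g(1)] f g by blast
  qed
qed

lemma normalised_representative:
  assumes "c \<in> topspace (funs_mod_const T)" and p: "p \<in> topspace T"
  shows "restrict (increment c p) (topspace T) \<in> continuous_funs T"
    and "c = const_class T (restrict (increment c p) (topspace T))"
proof -
  obtain f where f: "f \<in> continuous_funs T" "c = const_class T f"
    using assms(1) unfolding topspace_funs_mod_const by blast
  have eq: "restrict (increment c p) (topspace T) x = f x + - f p" if "x \<in> topspace T" for x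
    using that p by (simp add: f increment_const_class)
  have "continuous_map T euclideanreal (\<lambda>x. f x + - f p)"
    using f(1) by (intro continuous_intros) (auto simp: continuous_funs_def)
  then have "continuous_map T euclideanreal (restrict (increment c p) (topspace T))"
    by (rule continuous_map_eq) (rule eq[symmetric])
  then have cf: "restrict (increment c p) (topspace T) \<in> continuous_funs T"
    by (simp add: continuous_funs_def)
  show "restrict (increment c p) (topspace T) \<in> continuous_funs T"
    by (rule cf)
  show "c = const_class T (restrict (increment c p) (topspace T))"
    using const_class_eq[OF f(1) cf eq] f(2) by blast
qed

text \<open>
  Finitely many of the open sets on which the convergence is uniform cover a compact set.
\<close>

lemma locally_uniform_limit_imp_compact:
  assumes lim: "locally_uniform_limit T f F" and K: "compactin T K"
  shows "uniform_limit K (\<lambda>g. g) f F"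
proof -
  define \<U> where "\<U> = {U. openin T U \<and> uniform_limit U (\<lambda>g. g) f F}"
  have "K \<subseteq> \<Union>\<U>"
    using lim compactin_subset_topspace[OF K]
    unfolding locally_uniform_limit_def \<U>_def by blast
  moreover have "\<And>U. U \<in> \<U> \<Longrightarrow> openin T U"
    by (simp add: \<U>_def)
  ultimately obtain \<F> where \<F>: "finite \<F>" "\<F> \<subseteq> \<U>" "K \<subseteq> \<Union>\<F>"
    using K by (meson compactinD)
  have "\<forall>\<^sub>F g in F. \<forall>x\<in>K. dist (g x) (f x) < e" if "e > 0" for e
  proof -
    have "\<forall>\<^sub>F g in F. \<forall>U\<in>\<F>. \<forall>x\<in>U. dist (g x) (f x) < e"
      using \<F> that unfolding \<U>_def uniform_limit_iff
      by (intro eventually_ball_finite) auto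
    then show ?thesis
      by (rule eventually_mono) (use \<F>(3) in blast)
  qed
  then show ?thesis
    unfolding uniform_limit_iff by blast
qed

text \<open>
  The basic open sets of \<open>C\<^sub>*\<close>: classes whose increments from \<open>p\<close>
  stay uniformly close to a given function on a compact set. The strict bound by
  \<open>\<delta>\<close> is expressed through a smaller \<open>\<eta>\<close>, which leaves room
  for a perturbation and so makes the set open.
\<close>

lemma openin_increment_near:
  assumes K: "compactin T K" and p: "p \<in> topspace T"
  shows "openin (funs_mod_const T)
           {c \<in> topspace (funs_mod_const T). \<exists>\<eta><\<delta>. \<forall>y\<in>K. \<bar>increment c p y - g y\<bar> \<le> \<eta>}"
    (is "openin _ ?W")
proof -
  have KT: "y \<in> topspace T" if "y \<in> K" for y
    using compactin_subset_topspace[OF K] that by blast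
  have pre: "{f \<in> continuous_funs T. const_class T f \<in> ?W} =
      {f \<in> continuous_funs T. \<exists>\<eta><\<delta>. \<forall>y\<in>K. \<bar>f y - f p - g y\<bar> \<le> \<eta>}" (is "_ = ?V")
    using p KT by (auto simp: const_class_in_topspace increment_const_class)
  have "openin_local_uniform T ?V"
    unfolding openin_local_uniform_def
  proof (intro conjI ballI allI impI)
    fix f F
    assume f: "f \<in> ?V" and F: "(\<forall>\<^sub>F h in F. h \<in> continuous_funs T) \<and> locally_uniform_limit T f F"
    obtain \<eta> where \<eta>: "\<eta> < \<delta>" "\<forall>y\<in>K. \<bar>f y - f p - g y\<bar> \<le> \<eta>"
      using f by blast
    have "compactin T (insert p K)"
      using K p by (metis compactin_Un compactin_sing insert_is_Un)
    then have "uniform_limit (insert p K) (\<lambda>h. h) f F"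
      using F locally_uniform_limit_imp_compact by blast
    \<comment> \<open>An increment sees the perturbation at two points, so twice a quarter of the gap
        is spent and the bound moves only halfway from \<open>\<eta>\<close> to \<open>\<delta>\<close>.\<close>
    then have "\<forall>\<^sub>F h in F. \<forall>y\<in>insert p K. dist (h y) (f y) < (\<delta> - \<eta>) / 4"
      using \<eta>(1) by (intro uniform_limitD) simp_all
    with conjunct1[OF F] show "\<forall>\<^sub>F h in F. h \<in> ?V"
    proof eventually_elim
      case (elim h)
      have "\<bar>h y - h p - g y\<bar> \<le> (\<delta> + \<eta>) / 2" if "y \<in> K" for y
      proof -
        have "\<bar>h y - f y\<bar> < (\<delta> - \<eta>) / 4" "\<bar>h p - f p\<bar> < (\<delta> - \<eta>) / 4"
          using elim that by (auto simp: dist_real_def)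
        moreover have "\<bar>f y - f p - g y\<bar> \<le> \<eta>" using \<eta> that by blast
        ultimately show ?thesis by argo
      qed
      moreover have "(\<delta> + \<eta>) / 2 < \<delta>" using \<eta>(1) by simp
      ultimately show ?case using elim by blast
    qed
  qed blast
  moreover have "?W \<subseteq> const_class T ` continuous_funs T"
    unfolding topspace_funs_mod_const by blast
  ultimately show ?thesis
    using pre by (simp add: funs_mod_const_def openin_quotient_topology)
qed

corollary openin_increment_near_at:
  assumes x: "x \<in> topspace T" and y: "y \<in> topspace T"
  shows "openin (funs_mod_const T) {c \<in> topspace (funs_mod_const T). \<bar>increment c x y - a\<bar> < \<delta>}"
proof -
  have "(\<exists>\<eta><\<delta>. \<forall>z\<in>{y}. \<bar>increment c x z - a\<bar> \<le> \<eta>) \<longleftrightarrow> \<bar>increment c x y - a\<bar> < \<delta>" for c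
    by (auto intro: le_less_trans)
  then show ?thesis
    using openin_increment_near[of T "{y}" x \<delta> "\<lambda>_. a"] x y by simp
qed

text \<open>
  Two different classes have a different increment, and increments are continuous.
\<close>

lemma Hausdorff_funs_mod_const: "Hausdorff_space (funs_mod_const T)"
  unfolding Hausdorff_space_def
proof (intro allI impI, elim conjE)
  fix c c'
  assume c: "c \<in> topspace (funs_mod_const T)" "c' \<in> topspace (funs_mod_const T)" "c \<noteq> c'"
  then obtain x y where xy: "x \<in> topspace T" "y \<in> topspace T" "increment c x y \<noteq> increment c' x y"
    using increment_determines_class by blast
  define \<delta> where "\<delta> = \<bar>increment c x y - increment c' x y\<bar> / 2"
  have \<delta>: "\<delta> > 0" using xy by (simp add: \<delta>_def)
  let ?N = "\<lambda>b. {b' \<in> topspace (funs_mod_const T). \<bar>increment b' x y - increment b x y\<bar> < \<delta>}"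
  have "disjnt (?N c) (?N c')"
  proof -
    have "\<not> (\<bar>t - increment c x y\<bar> < \<delta> \<and> \<bar>t - increment c' x y\<bar> < \<delta>)" for t
      unfolding \<delta>_def by argo
    then show ?thesis
      by (auto simp: disjnt_iff)
  qed
  moreover have "c \<in> ?N c" "c' \<in> ?N c'"
    using c \<delta> by simp_all
  moreover have "openin (funs_mod_const T) (?N b)" for b
    by (rule openin_increment_near_at[OF xy(1,2)])
  ultimately show "\<exists>U V. openin (funs_mod_const T) U \<and> openin (funs_mod_const T) V \<and>
      c \<in> U \<and> c' \<in> V \<and> disjnt U V"
    by meson
qed

text \<open>
  All convergence in \<open>C\<^sub>*\<close> below comes from local uniform convergence of suitable
  representatives. The claim follows from the defining property of the topology on
  \<open>C(T)\<close>, applied to the image filter.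
\<close>

lemma limitin_const_class:
  assumes f: "\<forall>\<^sub>F n in G. f n \<in> continuous_funs T" and l: "l \<in> continuous_funs T"
    and lim: "\<And>x. x \<in> topspace T \<Longrightarrow> \<exists>U. openin T U \<and> x \<in> U \<and> uniform_limit U f l G"
  shows "limitin (funs_mod_const T) (\<lambda>n. const_class T (f n)) (const_class T l) G"
  unfolding limitin_def
proof (intro conjI allI impI)
  show "const_class T l \<in> topspace (funs_mod_const T)"
    using l by (rule const_class_in_topspace)
  fix W assume W: "openin (funs_mod_const T) W \<and> const_class T l \<in> W"
  then have "openin_local_uniform T {h \<in> continuous_funs T. const_class T h \<in> W}" (is "openin_local_uniform T ?V")
    by (simp add: funs_mod_const_def openin_quotient_topology)
  moreover have "locally_uniform_limit T l (filtermap f G)"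
    using lim unfolding locally_uniform_limit_def uniform_limit_iff eventually_filtermap by simp
  moreover have "\<forall>\<^sub>F h in filtermap f G. h \<in> continuous_funs T"
    using f by (simp add: eventually_filtermap)
  moreover have "l \<in> ?V"
    using l W by simp
  ultimately have "\<forall>\<^sub>F h in filtermap f G. h \<in> ?V"
    unfolding openin_local_uniform_def by meson
  then show "\<forall>\<^sub>F n in G. const_class T (f n) \<in> W"
    unfolding eventually_filtermap by (rule eventually_mono) blast
qed


section \<open>Nonexpansive functions and the metric embedding\<close>

context Metric_space
begin

lemma nonexpansive_in_continuous_funs:
  assumes ext: "f \<in> extensional M"
    and lip: "\<And>x y. x \<in> M \<Longrightarrow> y \<in> M \<Longrightarrow> \<bar>f x - f y\<bar> \<le> d x y"
  shows "f \<in> continuous_funs mtopology"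
proof -
  have "openin mtopology {x \<in> M. f x \<in> U}" if "open U" for U
    unfolding openin_mtopology
  proof (intro conjI allI impI)
    fix x assume x: "x \<in> {x \<in> M. f x \<in> U}"
    then obtain e where e: "e > 0" "ball (f x) e \<subseteq> U"
      using \<open>open U\<close> open_contains_ball by blast
    have "mball x e \<subseteq> {x \<in> M. f x \<in> U}"
    proof
      fix y assume y: "y \<in> mball x e"
      then have "f y \<in> ball (f x) e"
        using lip[of x y] by (simp add: dist_real_def)
      then show "y \<in> {x \<in> M. f x \<in> U}"
        using e y by auto
    qed
    then show "\<exists>r>0. mball x r \<subseteq> {x \<in> M. f x \<in> U}"
      using e by blast
  qed auto
  then have "continuous_map mtopology euclideanreal f"
    by (simp add: continuous_map)
  then show ?thesis
    using ext by (simp add: continuous_funs_def)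
qed

lemma dist_in_continuous_funs: "x \<in> M \<Longrightarrow> restrict (d x) M \<in> continuous_funs mtopology"
  by (rule nonexpansive_in_continuous_funs) (auto, metis commute mdist_reverse_triangle)

text \<open>
  This lemma and \<open>equi_nonexpansive_uniform_limit\<close> are the two halves of the
  Arzela--Ascoli argument for functions with common Lipschitz constant 1: convergence on a dense set
  spreads to every point, and pointwise convergence is uniform on compact sets. In both cases the
  value at a point is controlled by the value at a nearby point of a dense set or of a finite net.
\<close>

lemma equi_nonexpansive_convergent:
  fixes g :: "nat \<Rightarrow> 'a \<Rightarrow> real"
  assumes lip: "\<And>n x y. x \<in> M \<Longrightarrow> y \<in> M \<Longrightarrow> \<bar>g n x - g n y\<bar> \<le> d x y"
    and D: "mtopology closure_of D = M" "D \<subseteq> M"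
    and conv: "\<And>x. x \<in> D \<Longrightarrow> convergent (\<lambda>n. g n x)"
    and x: "x \<in> M"
  shows "convergent (\<lambda>n. g n x)"
proof -
  have "Cauchy (\<lambda>n. g n x)"
  proof (rule metric_CauchyI)
    fix e :: real assume e: "e > 0"
    have "\<forall>r>0. \<exists>y\<in>D. y \<in> mball x r"
      using x D(1) unfolding metric_closure_of by blast
    then obtain y where y: "y \<in> D" "d x y < e / 3"
      using e by (metis divide_pos_pos in_mball zero_less_numeral)
    have "Cauchy (\<lambda>n. g n y)"
      using conv[OF y(1)] by (rule convergent_Cauchy)
    then obtain N where N: "\<And>m n. m \<ge> N \<Longrightarrow> n \<ge> N \<Longrightarrow> dist (g m y) (g n y) < e / 3"
      using e by (metis metric_CauchyD divide_pos_pos zero_less_numeral)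
    have "dist (g m x) (g n x) < e" if "m \<ge> N" "n \<ge> N" for m n
    proof -
      have "\<bar>g m x - g m y\<bar> < e / 3" "\<bar>g n x - g n y\<bar> < e / 3"
        using lip[of x y m] lip[of x y n] x y D(2) by auto
      moreover have "\<bar>g m y - g n y\<bar> < e / 3"
        using N[OF that] by (simp add: dist_real_def)
      ultimately show ?thesis
        unfolding dist_real_def by argo
    qed
    then show "\<exists>N. \<forall>m\<ge>N. \<forall>n\<ge>N. dist (g m x) (g n x) < e"
      by blast
  qed
  then show ?thesis
    by (simp add: real_Cauchy_convergent)
qed

lemma nonexpansive_limit:
  fixes g :: "nat \<Rightarrow> 'a \<Rightarrow> real"
  assumes lip: "\<And>n x y. x \<in> M \<Longrightarrow> y \<in> M \<Longrightarrow> \<bar>g n x - g n y\<bar> \<le> d x y"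
    and lim: "\<And>x. x \<in> M \<Longrightarrow> (\<lambda>n. g n x) \<longlonglongrightarrow> l x"
    and "x \<in> M" "y \<in> M"
  shows "\<bar>l x - l y\<bar> \<le> d x y"
proof -
  have "(\<lambda>n. \<bar>g n x - g n y\<bar>) \<longlonglongrightarrow> \<bar>l x - l y\<bar>"
    by (intro tendsto_intros lim assms)
  then show ?thesis
    by (rule LIMSEQ_le_const2) (use lip assms(3,4) in blast)
qed

lemma equi_nonexpansive_uniform_limit:
  fixes g :: "nat \<Rightarrow> 'a \<Rightarrow> real"
  assumes lip: "\<And>n x y. x \<in> M \<Longrightarrow> y \<in> M \<Longrightarrow> \<bar>g n x - g n y\<bar> \<le> d x y"
    and lim: "\<And>x. x \<in> M \<Longrightarrow> (\<lambda>n. g n x) \<longlonglongrightarrow> l x"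
    and K: "compactin mtopology K"
  shows "uniform_limit K g l sequentially"
  unfolding uniform_limit_iff
proof (intro allI impI)
  fix e :: real assume e: "e > 0"
  have KM: "K \<subseteq> M"
    using compactin_subset_topspace[OF K] by simp
  have "mtotally_bounded K"
    using K by (rule compactin_imp_mtotally_bounded)
  then obtain A where A: "finite A" "A \<subseteq> K" "K \<subseteq> (\<Union>a\<in>A. mball a (e / 3))"
    using e unfolding mtotally_bounded_def by (metis divide_pos_pos zero_less_numeral)
  have "\<forall>\<^sub>F n in sequentially. \<forall>a\<in>A. dist (g n a) (l a) < e / 3"
    using A KM e lim by (intro eventually_ball_finite ballI tendstoD) auto
  then show "\<forall>\<^sub>F n in sequentially. \<forall>x\<in>K. dist (g n x) (l x) < e"
  proof eventually_elim
    case (elim n)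
    show ?case
    proof
      fix x assume "x \<in> K"
      then obtain a where a: "a \<in> A" "x \<in> M" "a \<in> M" "d a x < e / 3"
        using A(3) by auto
      have "\<bar>g n a - l a\<bar> < e / 3"
        using elim a(1) by (simp add: dist_real_def)
      moreover have "\<bar>g n a - g n x\<bar> < e / 3"
        using lip[OF a(3,2), of n] a(4) by linarith
      moreover have "\<bar>l a - l x\<bar> < e / 3"
        using nonexpansive_limit[of g l, OF lip lim a(3,2)] a(4) by linarith
      ultimately show "dist (g n x) (l x) < e"
        unfolding dist_real_def by argo
    qed
  qed
qed

lemma metric_embedding_in_topspace:
  "x \<in> M \<Longrightarrow> metric_embedding M d x \<in> topspace (funs_mod_const mtopology)"
  unfolding metric_embedding_def by (intro const_class_in_topspace dist_in_continuous_funs)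

lemma increment_metric_embedding:
  "x \<in> M \<Longrightarrow> p \<in> M \<Longrightarrow> y \<in> M \<Longrightarrow> increment (metric_embedding M d x) p y = d x y - d x p"
  by (simp add: metric_embedding_def increment_const_class)

lemma inj_on_metric_embedding: "inj_on (metric_embedding M d) M"
proof (rule inj_onI)
  fix x y assume xy: "x \<in> M" "y \<in> M" and "metric_embedding M d x = metric_embedding M d y"
  then have "d x y - d x x = d y y - d y x"
    by (metis increment_metric_embedding)
  then have "d x y = 0"
    using xy by (simp add: commute)
  then show "x = y"
    using xy by simp
qed

text \<open>
  By the triangle inequality, \<open>x' \<rightarrow> x\<close> forces \<open>d x' \<rightarrow> d
  x\<close> uniformly on the whole space.
\<close>

lemma continuous_metric_embedding:
  "continuous_map mtopology (funs_mod_const mtopology) (metric_embedding M d)"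
  unfolding continuous_map_atin metric_embedding_def
proof
  fix x assume "x \<in> topspace mtopology"
  then have x: "x \<in> M" by simp
  have near: "\<forall>\<^sub>F x' in atin mtopology x. x' \<in> mball x e" if "e > 0" for e
    unfolding eventually_atin using that x by (intro disjI2 exI[of _ "mball x e"]) auto
  show "limitin (funs_mod_const mtopology) (\<lambda>x. const_class mtopology (restrict (d x) M))
          (const_class mtopology (restrict (d x) M)) (atin mtopology x)"
  proof (rule limitin_const_class)
    show "\<forall>\<^sub>F x' in atin mtopology x. restrict (d x') M \<in> continuous_funs mtopology"
      using near[of 1] by (rule eventually_mono) (auto intro: dist_in_continuous_funs)
    show "restrict (d x) M \<in> continuous_funs mtopology"
      using x by (rule dist_in_continuous_funs)
    have "uniform_limit M (\<lambda>x'. restrict (d x') M) (restrict (d x) M) (atin mtopology x)"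
      unfolding uniform_limit_iff
    proof (intro allI impI)
      fix e :: real assume "e > 0"
      then show "\<forall>\<^sub>F x' in atin mtopology x. \<forall>y\<in>M. dist (restrict (d x') M y) (restrict (d x) M y) < e"
      proof (rule eventually_mono[OF near], intro ballI)
        fix x' y assume x': "x' \<in> mball x e" and y: "y \<in> M"
        then have "\<bar>d x' y - d y x\<bar> \<le> d x' x"
          by (intro mdist_reverse_triangle) auto
        then show "dist (restrict (d x') M y) (restrict (d x) M y) < e"
          using x' y by (simp add: dist_real_def commute)
      qed
    qed
    then show "\<exists>U. openin mtopology U \<and> y \<in> U \<and>
        uniform_limit U (\<lambda>x'. restrict (d x') M) (restrict (d x) M) (atin mtopology x)"
      if "y \<in> topspace mtopology" for y
      using that by (intro exI[of _ M]) auto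
  qed
qed

text \<open>
  Bounding a single increment is a closed condition, so the Lipschitz bound of the distance
  functions passes to every point of the compactification. This is what makes Arzela--Ascoli
  applicable to sequences in the closure.
\<close>

lemma increment_closure_le:
  assumes c: "c \<in> funs_mod_const mtopology closure_of (metric_embedding M d ` M)"
    and xy: "x \<in> M" "y \<in> M"
  shows "\<bar>increment c x y\<bar> \<le> d x y"
proof (rule ccontr)
  assume "\<not> ?thesis"
  then have pos: "\<bar>increment c x y\<bar> - d x y > 0" (is "?\<delta> > 0") by simp
  let ?N = "{c' \<in> topspace (funs_mod_const mtopology). \<bar>increment c' x y - increment c x y\<bar> < ?\<delta>}"
  have "openin (funs_mod_const mtopology) ?N" "c \<in> ?N"
    using openin_increment_near_at[of x mtopology y] xy pos c
    by (auto simp: in_closure_of)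
  then have "\<exists>c'. c' \<in> metric_embedding M d ` M \<and> c' \<in> ?N"
    using c[unfolded in_closure_of] by meson
  then obtain z where z: "z \<in> M" "metric_embedding M d z \<in> ?N"
    by blast
  have "\<bar>d z y - d z x\<bar> \<le> d x y"
    using mdist_reverse_triangle[of y z x] z xy by (simp add: commute)
  moreover have "\<bar>d z y - d z x - increment c x y\<bar> < ?\<delta>"
    using z xy by (simp add: increment_metric_embedding)
  ultimately show False
    by argo
qed

end


section \<open>Compactifying an approximately geodesic space\<close>

text \<open>
  Geodesics need not exist in an incomplete space; connected sets along which the triangle
  inequality is almost an equality take their place.
\<close>

locale approximately_geodesic_space = Metric_space +
  assumes locally_compact: "locally_compact_space mtopology"
    and separable: "separable_space mtopology"
    and near_geodesic: "\<And>x y e. x \<in> M \<Longrightarrow> y \<in> M \<Longrightarrow> e > 0 \<Longrightarrow>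
          \<exists>S. connectedin mtopology S \<and> x \<in> S \<and> y \<in> S \<and> (\<forall>z\<in>S. d x z + d z y < d x y + e)"
begin

text \<open>
  The distance from \<open>x\<close> takes every intermediate value on a connected set joining
  \<open>x\<close> to \<open>y\<close>.
\<close>

lemma point_on_sphere_near_geodesic:
  assumes xy: "x \<in> M" "y \<in> M" and r: "0 \<le> r" "r \<le> d x y" and e: "e > 0"
  obtains z where "z \<in> M" "d x z = r" "r + d z y < d x y + e"
proof -
  obtain S where S: "connectedin mtopology S" "x \<in> S" "y \<in> S"
    and near: "\<And>z. z \<in> S \<Longrightarrow> d x z + d z y < d x y + e"
    using near_geodesic[OF xy e] by blast
  have SM: "S \<subseteq> M"
    using connectedin_subset_topspace[OF S(1)] by simp
  have "continuous_map mtopology euclideanreal (restrict (d x) M)"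
    using dist_in_continuous_funs[OF xy(1)] by (simp add: continuous_funs_def)
  then have "connected (restrict (d x) M ` S)"
    using connectedin_continuous_map_image[OF _ S(1)] connectedin_iff_connected by metis
  moreover have "restrict (d x) M ` S = d x ` S"
    using SM by (intro image_cong) auto
  ultimately have "connected (d x ` S)"
    by simp
  moreover have "0 \<in> d x ` S" "d x y \<in> d x ` S"
    using S xy by (auto simp: image_iff intro: bexI[of _ x])
  ultimately have "r \<in> d x ` S"
    using r connectedD_interval by blast
  then obtain z where "z \<in> S" "d x z = r"
    by blast
  then show ?thesis
    using that[of z] SM near[of z] by auto
qed

text \<open>
  The radius also serves as the tolerance; \<open>basic_nbhd_detects_ball\<close> shows that this is
  small enough.
\<close>

definition basic_nbhd :: "'a \<Rightarrow> real \<Rightarrow> ('a \<Rightarrow> real) set set" where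
  "basic_nbhd x r =
     {c \<in> topspace (funs_mod_const mtopology). \<exists>\<eta><r. \<forall>y\<in>mcball x r. \<bar>increment c x y - d x y\<bar> \<le> \<eta>}"

lemma openin_basic_nbhd:
  "x \<in> M \<Longrightarrow> compactin mtopology (mcball x r) \<Longrightarrow> openin (funs_mod_const mtopology) (basic_nbhd x r)"
  unfolding basic_nbhd_def by (rule openin_increment_near) auto

lemma centre_in_basic_nbhd:
  assumes "x \<in> M" "r > 0"
  shows "metric_embedding M d x \<in> basic_nbhd x r"
  using assms
  by (auto simp: basic_nbhd_def metric_embedding_in_topspace increment_metric_embedding intro!: exI[of _ 0])

text \<open>
  The heart of the argument. Walking from \<open>x\<close> to a point \<open>x'\<close> outside the
  ball, one crosses the sphere of radius \<open>r\<close> at a point \<open>z\<close> that is closer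
  to \<open>x'\<close> than \<open>x\<close> is, by nearly \<open>r\<close>. So the increment of
  \<open>d x'\<close> from \<open>x\<close> to \<open>z\<close> is nearly \<open>-r\<close>, while
  that of \<open>d x\<close> is \<open>r\<close>: the two differ by almost \<open>2 * r\<close>.
  Since only a difference of more than \<open>r\<close> has to be seen, a slack of \<open>r\<close>
  in the choice of \<open>z\<close> is affordable.
\<close>

lemma basic_nbhd_detects_ball:
  assumes x: "x \<in> M" and x': "x' \<in> M" and r: "r > 0"
    and near: "metric_embedding M d x' \<in> basic_nbhd x r"
  shows "d x x' < r"
proof (rule ccontr)
  assume "\<not> ?thesis"
  then obtain z where z: "z \<in> M" "d x z = r" "r + d z x' < d x x' + r"
    using point_on_sphere_near_geodesic[OF x x', of r r] r by auto
  then have "\<bar>increment (metric_embedding M d x') x z - d x z\<bar> < r"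
    using near x by (force simp: basic_nbhd_def)
  then have "\<bar>d x' z - d x' x - d x z\<bar> < r"
    using x x' z(1) by (simp add: increment_metric_embedding)
  then show False
    using z by (simp add: commute)
qed

lemma small_compact_balls:
  assumes x: "x \<in> M" and U: "openin mtopology U" "x \<in> U"
  obtains r where "r > 0" "compactin mtopology (mcball x r)" "mcball x r \<subseteq> U"
proof -
  obtain V K where V: "openin mtopology V" "compactin mtopology K" "x \<in> V" "V \<subseteq> K"
    using locally_compact x unfolding locally_compact_space_def by auto
  have "openin mtopology (U \<inter> V)" "x \<in> U \<inter> V"
    using U V by auto
  then obtain r where r: "r > 0" "mcball x r \<subseteq> U \<inter> V"
    unfolding openin_mtopology_mcball by blast
  then have "compactin mtopology (mcball x r)"
    using closed_compactin[OF V(2), of "mcball x r"] V(4) by blast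
  then show ?thesis
    using that r by blast
qed

lemma embedding_map_metric_embedding:
  "embedding_map mtopology (funs_mod_const mtopology) (metric_embedding M d)"
  unfolding embedding_map_def
proof (rule bijective_open_imp_homeomorphic_map)
  let ?C = "funs_mod_const mtopology" and ?i = "metric_embedding M d"
  show "continuous_map mtopology (subtopology ?C (?i ` topspace mtopology)) ?i"
    by (intro continuous_map_into_subtopology continuous_metric_embedding) auto
  show "inj_on ?i (topspace mtopology)"
    using inj_on_metric_embedding by simp
  show "?i ` topspace mtopology = topspace (subtopology ?C (?i ` topspace mtopology))"
    by (auto simp: metric_embedding_in_topspace)
  show "open_map mtopology (subtopology ?C (?i ` topspace mtopology)) ?i"
    unfolding open_map_def
  proof (intro allI impI)
    fix U assume U: "openin mtopology U"
    then have UM: "U \<subseteq> M"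
      using openin_subset by fastforce
    have "\<exists>T. openin (subtopology ?C (?i ` M)) T \<and> c \<in> T \<and> T \<subseteq> ?i ` U" if c: "c \<in> ?i ` U" for c
    proof -
      obtain x where x: "x \<in> U" "c = ?i x"
        using c by blast
      obtain r where r: "r > 0" "compactin mtopology (mcball x r)" "mcball x r \<subseteq> U"
        using small_compact_balls[of x U] U x UM by blast
      have xM: "x \<in> M"
        using x UM by blast
      have "openin (subtopology ?C (?i ` M)) (?i ` M \<inter> basic_nbhd x r)"
        using openin_basic_nbhd[OF xM r(2)] openin_subtopology_Int2 by blast
      moreover have "c \<in> ?i ` M \<inter> basic_nbhd x r"
        using x xM r(1) centre_in_basic_nbhd by blast
      moreover have "?i ` M \<inter> basic_nbhd x r \<subseteq> ?i ` U"
      proof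
        fix c' assume "c' \<in> ?i ` M \<inter> basic_nbhd x r"
        then obtain x' where x': "x' \<in> M" "c' = ?i x'" "?i x' \<in> basic_nbhd x r"
          by blast
        then have "d x x' < r"
          using basic_nbhd_detects_ball[OF xM _ r(1)] by blast
        then have "x' \<in> U"
          using r(3) x' xM by (auto simp: subset_iff)
        then show "c' \<in> ?i ` U"
          using x' by blast
      qed
      ultimately show ?thesis
        by blast
    qed
    then show "openin (subtopology ?C (?i ` topspace mtopology)) (?i ` U)"
      using openin_subopen[of "subtopology ?C (?i ` M)" "?i ` U"] by simp
  qed
qed

text \<open>
  Inside the neighbourhood \<open>basic_nbhd x r\<close>, every embedded point comes from the
  compact ball \<open>mcball x r\<close>, whose image is compact and hence closed. A limit of
  embedded points that lies in this neighbourhood is therefore itself embedded.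
\<close>

lemma embedded_points_open:
  "openin (metric_compactification M d) (metric_embedding M d ` M)"
proof -
  let ?C = "funs_mod_const mtopology" and ?i = "metric_embedding M d"
  have "\<exists>T. openin (metric_compactification M d) T \<and> c \<in> T \<and> T \<subseteq> ?i ` M" if c: "c \<in> ?i ` M" for c
  proof -
    obtain x where x: "x \<in> M" "c = ?i x"
      using c by blast
    obtain r where r: "r > 0" "compactin mtopology (mcball x r)"
      using small_compact_balls[of x M] x by blast
    have op: "openin ?C (basic_nbhd x r)"
      using openin_basic_nbhd x r by blast
    let ?T = "?C closure_of (?i ` M) \<inter> basic_nbhd x r"
    have ball: "basic_nbhd x r \<inter> ?i ` M \<subseteq> ?i ` mcball x r"
    proof
      fix c' assume "c' \<in> basic_nbhd x r \<inter> ?i ` M"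
      then obtain x' where x': "x' \<in> M" "c' = ?i x'" "?i x' \<in> basic_nbhd x r"
        by blast
      then have "d x x' < r"
        using basic_nbhd_detects_ball[OF x(1) _ r(1)] by blast
      then show "c' \<in> ?i ` mcball x r"
        using x' x(1) by auto
    qed
    have "closedin ?C (?i ` mcball x r)"
      using r(2) continuous_metric_embedding Hausdorff_funs_mod_const
      by (blast intro: compactin_imp_closedin image_compactin)
    then have "?C closure_of (basic_nbhd x r \<inter> ?i ` M) \<subseteq> ?i ` mcball x r"
      using ball by (rule closure_of_minimal[rotated])
    then have "?T \<subseteq> ?i ` mcball x r"
      using openin_Int_closure_of_subset[OF op, of "?i ` M"] by blast
    then have "?T \<subseteq> ?i ` M"
      using mcball_subset_mspace by blast
    moreover have "openin (metric_compactification M d) ?T"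
      using op by (simp add: metric_compactification_def Let_def openin_subtopology_Int2)
    moreover have "c \<in> ?T"
      using x r(1) centre_in_basic_nbhd[OF x(1) r(1)] metric_embedding_in_topspace
        closure_of_subset[of "?i ` M" ?C] by blast
    ultimately show ?thesis
      by blast
  qed
  then show ?thesis
    using openin_subopen[of "metric_compactification M d" "?i ` M"] by simp
qed

text \<open>
  Represent the classes by functions vanishing at a common point \<open>p\<close>. These are
  nonexpansive and bounded pointwise, so a diagonal subsequence converges on a countable dense set,
  hence everywhere, and by local compactness locally uniformly.
\<close>

lemma seq_compact_metric_compactification:
  "seq_compact_space (metric_compactification M d)"
  unfolding seq_compact_space_def
proof (intro allI impI)
  let ?C = "funs_mod_const mtopology"
  let ?cl = "?C closure_of (metric_embedding M d ` M)"
  fix \<sigma> :: "nat \<Rightarrow> ('a \<Rightarrow> real) set"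
  assume "range \<sigma> \<subseteq> topspace (metric_compactification M d)"
  then have \<sigma>: "\<sigma> n \<in> ?cl" "\<sigma> n \<in> topspace ?C" for n
    by (auto simp: metric_compactification_def Let_def image_subset_iff)
  have "M \<noteq> {}"
    using \<sigma>(1) by force
  then obtain p where p: "p \<in> M"
    by blast
  define f where "f n = restrict (increment (\<sigma> n) p) M" for n
  have f: "f n \<in> continuous_funs mtopology" "\<sigma> n = const_class mtopology (f n)" for n
    using normalised_representative[OF \<sigma>(2), of p n] p by (auto simp: f_def)
  have lip: "\<bar>f n x - f n y\<bar> \<le> d x y" if "x \<in> M" "y \<in> M" for n x y
  proof -
    have "f n y - f n x = increment (\<sigma> n) x y"
      using that by (simp add: f_def increment_def Let_def)
    then show ?thesis
      using increment_closure_le[OF \<sigma>(1) that, of n] by (simp add: abs_minus_commute)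
  qed
  have fp: "f n p = 0" for n
    using p by (simp add: f_def increment_def)
  have bound: "\<bar>f n x\<bar> \<le> d p x" if "x \<in> M" for n x
    using lip[OF that p, of n] by (simp add: fp commute)
  obtain D where D: "countable D" "D \<subseteq> M" "mtopology closure_of D = M"
    using separable unfolding separable_space_def by auto
  \<comment> \<open>Dividing by \<open>d p x + 1\<close> turns the bound that depends on \<open>x\<close> into a uniform one.\<close>
  have "norm (f n x / (d p x + 1)) \<le> 1" if "x \<in> D" for n x
  proof -
    have "\<bar>f n x\<bar> \<le> d p x + 1"
      using bound[of x n] that D(2) by force
    then show ?thesis
      by (simp add: add_nonneg_pos)
  qed
  then obtain k where k: "strict_mono (k :: nat \<Rightarrow> nat)"
    and lim: "\<And>x. x \<in> D \<Longrightarrow> \<exists>l. (\<lambda>n. f (k n) x / (d p x + 1)) \<longlonglongrightarrow> l"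
    using function_convergent_subsequence[OF D(1), of "\<lambda>n x. f n x / (d p x + 1)" 1] by blast
  have "convergent (\<lambda>n. f (k n) x)" if x: "x \<in> D" for x
  proof -
    obtain l where "(\<lambda>n. f (k n) x / (d p x + 1)) \<longlonglongrightarrow> l"
      using lim[OF x] by blast
    then have "(\<lambda>n. f (k n) x / (d p x + 1) * (d p x + 1)) \<longlonglongrightarrow> l * (d p x + 1)"
      by (intro tendsto_intros)
    moreover have "d p x + 1 \<noteq> 0"
      using nonneg[of p x] by linarith
    ultimately show ?thesis
      unfolding convergent_def by auto
  qed
  then have conv: "convergent (\<lambda>n. f (k n) x)" if "x \<in> M" for x
    using equi_nonexpansive_convergent[of "\<lambda>n. f (k n)", OF lip D(3,2) _ that] by blast
  define l where "l = restrict (\<lambda>x. lim (\<lambda>n. f (k n) x)) M"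
  have l: "(\<lambda>n. f (k n) x) \<longlonglongrightarrow> l x" if "x \<in> M" for x
    using conv[OF that] that by (simp add: l_def convergent_LIMSEQ_iff)
  have "\<bar>l x - l y\<bar> \<le> d x y" if "x \<in> M" "y \<in> M" for x y
    using nonexpansive_limit[of "\<lambda>n. f (k n)" l, OF lip l that] by blast
  then have lC: "l \<in> continuous_funs mtopology"
    by (intro nonexpansive_in_continuous_funs) (auto simp: l_def)
  have "\<exists>U. openin mtopology U \<and> x \<in> U \<and> uniform_limit U (\<lambda>n. f (k n)) l sequentially"
    if x: "x \<in> topspace mtopology" for x
  proof -
    obtain V K where V: "openin mtopology V" "compactin mtopology K" "x \<in> V" "V \<subseteq> K"
      using locally_compact x unfolding locally_compact_space_def by blast
    have "uniform_limit K (\<lambda>n. f (k n)) l sequentially"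
      using equi_nonexpansive_uniform_limit[of "\<lambda>n. f (k n)" l, OF lip l V(2)] by blast
    then show ?thesis
      using V uniform_limit_on_subset[OF _ V(4)] by meson
  qed
  then have "limitin ?C (\<lambda>n. const_class mtopology (f (k n))) (const_class mtopology l) sequentially"
    by (intro limitin_const_class) (simp_all add: f(1) lC)
  then have lim: "limitin ?C (\<sigma> \<circ> k) (const_class mtopology l) sequentially"
    by (simp add: f(2)[symmetric] comp_def)
  then have "const_class mtopology l \<in> ?cl"
    by (rule limitin_closedin) (auto simp: \<sigma>)
  then have "limitin (metric_compactification M d) (\<sigma> \<circ> k) (const_class mtopology l) sequentially"
    using lim \<sigma>(1) by (simp add: metric_compactification_def Let_def limitin_subtopology)
  then show "\<exists>l r. strict_mono r \<and> limitin (metric_compactification M d) (\<sigma> \<circ> r) l sequentially"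
    using k by blast
qed

theorem metric_compactification_is_compactification:
  "is_compactification mtopology (metric_compactification M d) (metric_embedding M d)"
  unfolding is_compactification_def
proof (intro conjI)
  let ?C = "funs_mod_const mtopology" and ?i = "metric_embedding M d"
  have sub: "?i ` M \<subseteq> ?C closure_of (?i ` M)"
    by (intro closure_of_subset) (auto simp: metric_embedding_in_topspace)
  show "seq_compact_space (metric_compactification M d)"
    by (rule seq_compact_metric_compactification)
  show "Hausdorff_space (metric_compactification M d)"
    by (simp add: metric_compactification_def Let_def Hausdorff_space_subtopology Hausdorff_funs_mod_const)
  show "embedding_map mtopology (metric_compactification M d) ?i"
    using embedding_map_metric_embedding sub
    by (simp add: metric_compactification_def Let_def embedding_map_in_subtopology)
  show "openin (metric_compactification M d) (?i ` topspace mtopology)"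
    using embedded_points_open by simp
  show "metric_compactification M d closure_of ?i ` topspace mtopology
      = topspace (metric_compactification M d)"
    using sub closure_of_subset_topspace[of ?C "?i ` M"]
    by (simp add: metric_compactification_def Let_def closure_of_subtopology Int_absorb1 Int_absorb2)
qed

end

section \<open>Near-geodesics determine the topology\<close>

text \<open>
  Barth's argument that the Kobayashi distance of a hyperbolic manifold induces the manifold
  topology. A point \<open>x\<close> has a neighbourhood \<open>V\<close> with compact frontier, and
  \<open>d x\<close>, being continuous and positive there, is bounded below by some
  \<open>r\<close>. A connected set from \<open>x\<close> to a point outside \<open>V\<close> meets
  the frontier, so it cannot stay within distance \<open>r\<close> of \<open>x\<close>.
\<close>

theorem (in Metric_space) near_geodesics_determine_topology:
  assumes X: "topspace X = M" "Hausdorff_space X" "locally_compact_space X"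
    and cont: "\<And>x. x \<in> M \<Longrightarrow> continuous_map X euclideanreal (d x)"
    and conn: "\<And>x y e. x \<in> M \<Longrightarrow> y \<in> M \<Longrightarrow> e > 0 \<Longrightarrow>
          \<exists>S. connectedin X S \<and> x \<in> S \<and> y \<in> S \<and> (\<forall>z\<in>S. d x z < d x y + e)"
  shows "mtopology = X"
  unfolding topology_eq
proof (intro allI iffI)
  fix U assume U: "openin mtopology U"
  have "\<exists>T. openin X T \<and> x \<in> T \<and> T \<subseteq> U" if x: "x \<in> U" for x
  proof -
    obtain r where r: "r > 0" "mball x r \<subseteq> U"
      using U x unfolding openin_mtopology by blast
    have xM: "x \<in> M"
      using U x unfolding openin_mtopology by blast
    have "openin X {y \<in> topspace X. d x y \<in> {..<r}}"
      using cont[OF xM] by (rule openin_continuous_map_preimage) simp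
    moreover have "{y \<in> topspace X. d x y \<in> {..<r}} = mball x r"
      using xM by (auto simp: X(1))
    ultimately show ?thesis
      using r xM by (intro exI[of _ "mball x r"]) auto
  qed
  then show "openin X U"
    using openin_subopen by blast
next
  fix U assume U: "openin X U"
  show "openin mtopology U"
    unfolding openin_mtopology
  proof (intro conjI allI impI)
    show "U \<subseteq> M"
      using U X(1) openin_subset by blast
    fix x assume x: "x \<in> U"
    then have xM: "x \<in> M"
      using \<open>U \<subseteq> M\<close> by blast
    have "neighbourhood_base_of (compactin X) X"
      using X locally_compact_space_neighbourhood_base by blast
    then obtain V K where V: "openin X V" "compactin X K" "x \<in> V" "V \<subseteq> K" "K \<subseteq> U"
      using U x unfolding neighbourhood_base_of by meson
    have "closedin X K"
      using X(2) V(2) by (rule compactin_imp_closedin)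
    then have "X frontier_of V \<subseteq> K"
      using V(4) closure_of_minimal unfolding frontier_of_def by blast
    then have F: "compactin X (X frontier_of V)"
      using V(2) closed_compactin closedin_frontier_of by blast
    have "compact (d x ` (X frontier_of V))"
      using image_compactin[OF F cont[OF xM]] by simp
    then have "closed (d x ` (X frontier_of V))"
      by (rule compact_imp_closed)
    moreover have "0 \<notin> d x ` (X frontier_of V)"
    proof
      assume "0 \<in> d x ` (X frontier_of V)"
      then obtain z where z: "z \<in> X frontier_of V" "d x z = 0"
        by auto
      then have "z \<in> M"
        using frontier_of_subset_topspace[of X V] X(1) by blast
      then have "z = x"
        using z xM by simp
      then show False
        using z V(1,3) by (simp add: frontier_of_def interior_of_openin)
    qed
    ultimately obtain r where r: "r > 0" "ball 0 r \<inter> d x ` (X frontier_of V) = {}"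
      by (metis separate_point_closed[of "d x ` (X frontier_of V)" 0] disjoint_iff image_iff linorder_not_less mem_ball)
    have "mball x r \<subseteq> V"
    proof (rule ccontr)
      assume "\<not> ?thesis"
      then obtain y where y: "y \<in> M" "d x y < r" "y \<notin> V"
        unfolding subset_iff in_mball by blast
      then obtain S where S: "connectedin X S" "x \<in> S" "y \<in> S" "\<forall>z\<in>S. d x z < d x y + (r - d x y)"
        using conn[OF xM y(1), of "r - d x y"] by auto
      then obtain z where "z \<in> S" "z \<in> X frontier_of V"
        using connectedin_Int_frontier_of[of X S V] V(3) y(3) by blast
      then have "d x z \<in> ball 0 r \<inter> d x ` (X frontier_of V)"
        using S(4) by simp
      then show False
        using r by blast
    qed
    then show "\<exists>r>0. mball x r \<subseteq> U"
      using r V by blast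
  qed
qed


section \<open>Geodesics of the Poincare disc\<close>

text \<open>
  The hyperbolic law that the distances along a radius of the disc add up.
\<close>

lemma artanh_segment_add:
  fixes s u :: real
  assumes "0 \<le> s" "s \<le> u" "u < 1"
  shows "artanh s + artanh ((u - s) / (1 - s * u)) = artanh u"
proof -
  have su: "s * u < 1"
    using assms by (smt (verit) mult_left_le_one_le)
  have pos: "(1 + s) / (1 - s) > 0" "((1 + u) * (1 - s)) / ((1 - u) * (1 + s)) > 0"
    using assms by auto
  have "(1 + (u - s) / (1 - s * u)) / (1 - (u - s) / (1 - s * u))
      = ((1 - s * u) + (u - s)) / ((1 - s * u) - (u - s))"
    using su by (simp add: add_divide_distrib[symmetric] diff_divide_distrib[symmetric]
        add_divide_eq_iff diff_divide_eq_iff divide_add_eq_iff divide_diff_eq_iff)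
  also have "\<dots> = ((1 + u) * (1 - s)) / ((1 - u) * (1 + s))"
    by (simp add: algebra_simps)
  finally have v: "(1 + (u - s) / (1 - s * u)) / (1 - (u - s) / (1 - s * u))
      = ((1 + u) * (1 - s)) / ((1 - u) * (1 + s))" .
  have "(1 + s) / (1 - s) * (((1 + u) * (1 - s)) / ((1 - u) * (1 + s))) = (1 + u) / (1 - u)"
    using assms by (simp add: divide_simps)
  then show ?thesis
    using ln_mult_pos[OF pos] unfolding artanh_def v by (simp add: add_divide_distrib)
qed

lemma poincare_dist_eq_Moebius: "poincare_dist a b = artanh (cmod (Moebius_function 0 b a))"
  by (simp add: poincare_dist_def Moebius_function_simple)

lemma poincare_dist_nonneg:
  assumes "a \<in> ball 0 1" "b \<in> ball 0 1"
  shows "poincare_dist a b \<ge> 0"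
proof -
  have "cmod (Moebius_function 0 b a) < 1"
    using assms by (intro Moebius_function_norm_lt_1) auto
  then show ?thesis
    unfolding poincare_dist_eq_Moebius artanh_def by simp
qed

lemma one_minus_cnj_mult_nonzero:
  assumes "cmod a < 1" "cmod b < 1"
  shows "1 - cnj a * b \<noteq> 0" "1 + cnj a * b \<noteq> 0"
proof -
  have "cmod (cnj a * b) < 1"
    using assms by (metis complex_mod_cnj norm_mult_less mult_1)
  then show "1 - cnj a * b \<noteq> 0" "1 + cnj a * b \<noteq> 0"
    by (auto simp: add_eq_0_iff)
qed

lemma poincare_dist_Moebius_invariant:
  assumes a: "cmod a < 1" and z: "cmod z < 1" and w: "cmod w < 1"
  shows "poincare_dist (Moebius_function 0 (- a) z) (Moebius_function 0 (- a) w) = poincare_dist z w"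
proof -
  define A B where "A = 1 + cnj a * z" and "B = 1 + cnj a * w"
  have nz: "A \<noteq> 0" "B \<noteq> 0" "1 - cnj w * z \<noteq> 0" "1 - cnj a * a \<noteq> 0"
    using one_minus_cnj_mult_nonzero a z w by (auto simp: A_def B_def)
  have cB: "cnj B \<noteq> 0"
    using nz by simp
  have "(z + a) / A - (w + a) / B = (1 - cnj a * a) * (z - w) / (A * B)"
  proof -
    have "(z + a) / A - (w + a) / B = ((z + a) * B - (w + a) * A) / (A * B)"
      using nz by (simp add: diff_frac_eq)
    also have "(z + a) * B - (w + a) * A = (1 - cnj a * a) * (z - w)"
      by (simp add: A_def B_def algebra_simps)
    finally show ?thesis .
  qed
  moreover have "1 - cnj ((w + a) / B) * ((z + a) / A) = (1 - cnj a * a) * (1 - cnj w * z) / (A * cnj B)"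
  proof -
    have "1 - cnj ((w + a) / B) * ((z + a) / A) = (A * cnj B - cnj (w + a) * (z + a)) / (A * cnj B)"
      using nz(1) cB by (simp add: diff_divide_distrib mult.commute)
    also have "A * cnj B - cnj (w + a) * (z + a) = (1 - cnj a * a) * (1 - cnj w * z)"
      by (simp add: A_def B_def algebra_simps)
    finally show ?thesis .
  qed
  moreover have "(P * q / (A * B)) / (P * r / (A * cnj B)) = q / r * (cnj B / B)"
    if "P \<noteq> 0" "r \<noteq> 0" for P q r
    using that nz(1,2) cB by (simp add: divide_simps)
  ultimately have "((z + a) / A - (w + a) / B) / (1 - cnj ((w + a) / B) * ((z + a) / A))
      = (z - w) / (1 - cnj w * z) * (cnj B / B)"
    using nz(3,4) by (simp only:)
  moreover have "cmod (cnj B / B) = 1"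
    using nz(2) by (simp add: norm_divide)
  ultimately have "cmod (((z + a) / A - (w + a) / B) / (1 - cnj ((w + a) / B) * ((z + a) / A)))
      = cmod ((z - w) / (1 - cnj w * z))"
    by (simp only: norm_mult mult_1_right)
  then show ?thesis
    by (simp only: poincare_dist_def Moebius_function_simple A_def B_def complex_cnj_minus
        minus_mult_left[symmetric] diff_minus_eq_add)
qed

text \<open>
  Moving \<open>a\<close> to the origin by a Moebius transformation, the geodesic is a Euclidean
  radius.
\<close>

lemma poincare_geodesic:
  assumes "a \<in> ball 0 1" "b \<in> ball 0 1"
  obtains \<gamma> :: "real \<Rightarrow> complex" where
    "continuous_on {0..1} \<gamma>" "\<gamma> ` {0..1} \<subseteq> ball 0 1" "\<gamma> 0 = a" "\<gamma> 1 = b"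
    "\<And>t. t \<in> {0..1} \<Longrightarrow> poincare_dist a (\<gamma> t) + poincare_dist (\<gamma> t) b = poincare_dist a b"
proof -
  have ab: "cmod a < 1" "cmod b < 1"
    using assms by auto
  define w where "w = Moebius_function 0 a b"
  define \<gamma> where "\<gamma> t = Moebius_function 0 (- a) (of_real t * w)" for t :: real
  have w: "cmod w < 1"
    using Moebius_function_norm_lt_1[OF ab] by (simp add: w_def)
  have tw: "cmod (of_real t * w) < 1" if "t \<in> {0..1}" for t :: real
  proof -
    have "t * cmod w \<le> 1 * cmod w"
      using that by (intro mult_right_mono) auto
    then show ?thesis
      using w that by (simp add: norm_mult)
  qed
  have a: "a = Moebius_function 0 (- a) 0"
    by (simp add: Moebius_function_of_zero)
  have b: "b = Moebius_function 0 (- a) w"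
    unfolding w_def by (rule Moebius_function_compose[symmetric]) (use ab in auto)
  show ?thesis
  proof
    have "continuous_on (ball 0 1) (Moebius_function 0 (- a))"
      using ab by (intro holomorphic_on_imp_continuous_on Moebius_function_holomorphic) simp
    then have "continuous_on ((\<lambda>t. of_real t * w) ` {0..1::real}) (Moebius_function 0 (- a))"
      by (rule continuous_on_subset) (use tw in auto)
    then have "continuous_on {0..1} (Moebius_function 0 (- a) \<circ> (\<lambda>t. of_real t * w))"
      by (intro continuous_on_compose continuous_intros)
    then show "continuous_on {0..1} \<gamma>"
      by (simp add: \<gamma>_def comp_def)
    show "\<gamma> ` {0..1} \<subseteq> ball 0 1"
      using Moebius_function_norm_lt_1 tw ab by (auto simp: \<gamma>_def)
    show "\<gamma> 0 = a" "\<gamma> 1 = b"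
      using a b by (simp_all add: \<gamma>_def)
    fix t :: real assume t: "t \<in> {0..1}"
    define s u where "s = t * cmod w" and "u = cmod w"
    have s: "0 \<le> s" "s \<le> u" "u < 1"
      using t w by (auto simp: s_def u_def mult_left_le_one_le)
    have su: "s * u < 1"
      using s by (smt (verit) mult_left_le_one_le)
    have "poincare_dist a (\<gamma> t) = poincare_dist 0 (of_real t * w)"
      using poincare_dist_Moebius_invariant[OF ab(1), of 0 "of_real t * w"] tw[OF t] a
      by (simp add: \<gamma>_def)
    also have "\<dots> = artanh s"
      using t by (simp add: poincare_dist_def s_def norm_mult)
    finally have 1: "poincare_dist a (\<gamma> t) = artanh s" .
    have "poincare_dist (\<gamma> t) b = poincare_dist (of_real t * w) w"
      using poincare_dist_Moebius_invariant[OF ab(1), of "of_real t * w" w] tw[OF t] w b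
      by (simp add: \<gamma>_def)
    also have "\<dots> = artanh ((u - s) / (1 - s * u))"
    proof -
      have "of_real t * w - w = of_real (t - 1) * w"
        by (simp add: algebra_simps)
      then have "cmod (of_real t * w - w) = u - s"
        using t by (simp only: norm_mult norm_of_real) (simp add: s_def u_def algebra_simps)
      moreover have "1 - cnj w * (of_real t * w) = of_real (1 - s * u)"
      proof -
        have "cnj w * (of_real t * w) = of_real t * (w * cnj w)"
          by (simp add: mult_ac)
        also have "\<dots> = of_real (s * u)"
          by (simp only: complex_norm_square[symmetric]) (simp add: s_def u_def power2_eq_square)
        finally show ?thesis
          by simp
      qed
      then have "cmod (1 - cnj w * (of_real t * w)) = 1 - s * u"
        using su by (simp only: norm_of_real)
      ultimately show ?thesis
        by (simp add: poincare_dist_def norm_divide)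
    qed
    finally have 2: "poincare_dist (\<gamma> t) b = artanh ((u - s) / (1 - s * u))" .
    have "poincare_dist a b = poincare_dist 0 w"
      using poincare_dist_Moebius_invariant[OF ab(1), of 0 w] w a b by simp
    also have "\<dots> = artanh u"
      by (simp add: poincare_dist_def u_def)
    finally show "poincare_dist a (\<gamma> t) + poincare_dist (\<gamma> t) b = poincare_dist a b"
      using artanh_segment_add[OF s] 1 2 by simp
  qed
qed

section \<open>Holomorphic discs in charts\<close>

lemma norm_vector_scalar_mult:
  fixes v :: "complex^'n"
  shows "norm (c *s v) = cmod c * norm v"
  by (simp add: norm_vec_def norm_mult L2_set_right_distrib)

lemma manifold_chart_ball:
  assumes "complex_manifold E X \<A>" and x: "x \<in> topspace X"
  obtains U \<phi> R where "(U, \<phi>) \<in> \<A>" "is_chart E X U \<phi>" "x \<in> U" "R > 0"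
    "cball (\<phi> x) R \<inter> E \<subseteq> \<phi> ` U" "\<phi> ` U \<subseteq> E"
proof -
  obtain U \<phi> where U: "(U, \<phi>) \<in> \<A>" "x \<in> U"
    using assms unfolding complex_manifold_def by blast
  then have chart: "is_chart E X U \<phi>"
    using assms unfolding complex_manifold_def by blast
  then have "openin (top_of_set E) (\<phi> ` U)"
    by (simp add: is_chart_def)
  then obtain R where "R > 0" "cball (\<phi> x) R \<inter> E \<subseteq> \<phi> ` U" "\<phi> ` U \<subseteq> E"
    using U(2) unfolding openin_contains_cball by blast
  then show ?thesis
    using that U chart by blast
qed

lemma chart_inverse:
  assumes "is_chart E X U \<phi>"
  shows "inj_on \<phi> U" "continuous_map (top_of_set (\<phi> ` U)) X (inv_into U \<phi>)"
    "continuous_map (subtopology X U) euclidean \<phi>"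
proof -
  have U: "openin X U" and h: "homeomorphic_map (subtopology X U) (top_of_set (\<phi> ` U)) \<phi>"
    using assms by (auto simp: is_chart_def)
  have top: "topspace (subtopology X U) = U"
    using openin_subset[OF U] by auto
  show inj: "inj_on \<phi> U"
    using homeomorphic_imp_injective_map[OF h] by (simp only: top)
  show "continuous_map (subtopology X U) euclidean \<phi>"
    using homeomorphic_imp_continuous_map[OF h] continuous_map_in_subtopology by blast
  obtain g where g: "homeomorphic_maps (subtopology X U) (top_of_set (\<phi> ` U)) \<phi> g"
    using h by (auto simp: homeomorphic_map_maps)
  then have "continuous_map (top_of_set (\<phi> ` U)) (subtopology X U) g"
    and gU: "g (\<phi> y) = y" if "y \<in> U" for y
    using that unfolding homeomorphic_maps_def top by auto
  moreover have "g y = inv_into U \<phi> y" if "y \<in> topspace (top_of_set (\<phi> ` U))" for y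
    using that inj gU by auto
  ultimately have "continuous_map (top_of_set (\<phi> ` U)) (subtopology X U) (inv_into U \<phi>)"
    using g continuous_map_eq unfolding homeomorphic_maps_def by blast
  then show "continuous_map (top_of_set (\<phi> ` U)) X (inv_into U \<phi>)"
    using continuous_map_in_subtopology by blast
qed

lemma chart_preimage_open:
  assumes "is_chart E X U \<phi>" "open S"
  shows "openin X {y \<in> U. \<phi> y \<in> S}"
proof -
  have U: "openin X U"
    using assms by (simp add: is_chart_def)
  have "openin (subtopology X U) {y \<in> topspace (subtopology X U). \<phi> y \<in> S}"
    using chart_inverse(3)[OF assms(1)] by (rule openin_continuous_map_preimage) (simp add: assms)
  moreover have "topspace (subtopology X U) = U"
    using openin_subset[OF U] by auto
  ultimately show ?thesis
    using openin_trans_full[OF _ U] by (simp only:)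
qed

lemma locally_compact_complex_manifold:
  assumes "complex_manifold E X \<A>"
  shows "locally_compact_space X"
  unfolding locally_compact_space_def
proof
  fix x assume "x \<in> topspace X"
  then obtain U \<phi> R where U: "is_chart E X U \<phi>" "x \<in> U" "R > 0"
    "cball (\<phi> x) R \<inter> E \<subseteq> \<phi> ` U" "\<phi> ` U \<subseteq> E"
    using manifold_chart_ball[OF assms] by metis
  have "vec.subspace E"
    using assms by (simp add: complex_manifold_def)
  then have "subspace E"
    by (auto simp: vec.subspace_def subspace_def scaleR_vec_def vector_scalar_mult_def
        scaleR_conv_of_real)
  then have "compact (cball (\<phi> x) R \<inter> E)"
    by (intro compact_Int_closed closed_subspace) auto
  then have "compactin X (inv_into U \<phi> ` (cball (\<phi> x) R \<inter> E))"
    using U(4) chart_inverse(2)[OF U(1)]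
    by (intro image_compactin[of "top_of_set (\<phi> ` U)"]) (auto simp: compactin_subtopology)
  moreover have "openin X {y \<in> U. \<phi> y \<in> ball (\<phi> x) R}"
    using chart_preimage_open[OF U(1)] by blast
  moreover have "{y \<in> U. \<phi> y \<in> ball (\<phi> x) R} \<subseteq> inv_into U \<phi> ` (cball (\<phi> x) R \<inter> E)"
  proof
    fix y assume "y \<in> {y \<in> U. \<phi> y \<in> ball (\<phi> x) R}"
    then have "y = inv_into U \<phi> (\<phi> y)" "\<phi> y \<in> cball (\<phi> x) R \<inter> E"
      using chart_inverse(1)[OF U(1)] U(5) by auto
    then show "y \<in> inv_into U \<phi> ` (cball (\<phi> x) R \<inter> E)"
      by blast
  qed
  moreover have "x \<in> {y \<in> U. \<phi> y \<in> ball (\<phi> x) R}"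
    using U by simp
  ultimately show "\<exists>U K. openin X U \<and> compactin X K \<and> x \<in> U \<and> U \<subseteq> K"
    by blast
qed

text \<open>
  The disc is affine in the chart \<open>\<phi>\<close>. In any other chart it is a transition map
  composed with a complex affine map, and the chain rule for a complex linear Jacobian yields a
  complex derivative of every component.
\<close>

lemma linear_disc_in_chart:
  assumes man: "complex_manifold E X \<A>" and U: "(U, \<phi>) \<in> \<A>"
    and disc: "\<And>z. z \<in> ball 0 1 \<Longrightarrow> c + z *s u \<in> \<phi> ` U"
  shows "holomorphic_disc X \<A> (\<lambda>z. inv_into U \<phi> (c + z *s u))"
  unfolding holomorphic_disc_def
proof (intro conjI ballI allI, goal_cases)
  case 1
  have chart: "is_chart E X U \<phi>"
    using man U by (auto simp: complex_manifold_def)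
  have lin: "bounded_linear (\<lambda>z. z *s u)"
    unfolding linear_conv_bounded_linear[symmetric]
    by (intro linearI) (simp_all add: vec_eq_iff algebra_simps)
  have "continuous_on (ball 0 1) (\<lambda>z. c + z *s u)"
    by (intro continuous_intros linear_continuous_on lin)
  then have "continuous_map (top_of_set (ball 0 1)) (top_of_set (\<phi> ` U)) (\<lambda>z. c + z *s u)"
    using disc by (auto simp: continuous_map_in_subtopology)
  then show ?case
    using continuous_map_compose[OF _ chart_inverse(2)[OF chart],
        of "top_of_set (ball 0 1)" "\<lambda>z. c + z *s u"] by (simp add: comp_def)
next
  case (2 V\<psi>)
  show ?case
  proof (clarify)
    fix V \<psi> i
    assume "V\<psi> = (V, \<psi>)"
    then have V: "(V, \<psi>) \<in> \<A>"
      using 2 by simp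
    let ?h = "\<lambda>z. c + z *s u" and ?g = "\<psi> \<circ> inv_into U \<phi>"
    let ?D = "{z \<in> ball 0 1. inv_into U \<phi> (?h z) \<in> V}"
    have hol: "holomorphic_map_on ?g (\<phi> ` (U \<inter> V))"
    proof -
      have "\<forall>(U, \<phi>)\<in>\<A>. \<forall>(V, \<psi>)\<in>\<A>.
          holomorphic_map_on (\<psi> \<circ> inv_into U \<phi>) (\<phi> ` (U \<inter> V))"
        using man unfolding complex_manifold_def by (elim conjE)
      from bspec[OF this U] show ?thesis
        using V by auto
    qed
    have lin: "bounded_linear (\<lambda>z. z *s u)"
      unfolding linear_conv_bounded_linear[symmetric]
      by (intro linearI) (simp_all add: vec_eq_iff algebra_simps)
    have hD: "?h ` ?D \<subseteq> \<phi> ` (U \<inter> V)"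
    proof
      fix y assume "y \<in> ?h ` ?D"
      then obtain z where z: "z \<in> ball 0 1" "inv_into U \<phi> (?h z) \<in> V" "y = ?h z"
        by blast
      then have "inv_into U \<phi> y \<in> U" "\<phi> (inv_into U \<phi> y) = y"
        using disc[OF z(1)] by (auto simp: inv_into_into f_inv_into_f)
      then show "y \<in> \<phi> ` (U \<inter> V)"
        using z by (metis IntI imageI)
    qed
    have "(\<lambda>z. ?g (?h z) $ i) holomorphic_on ?D"
      unfolding holomorphic_on_def
    proof
      fix z assume z: "z \<in> ?D"
      then have "?h z \<in> \<phi> ` (U \<inter> V)"
        using hD by blast
      then obtain J where "(?g has_derivative (\<lambda>v. J *v v)) (at (?h z) within \<phi> ` (U \<inter> V))"
        using hol unfolding holomorphic_map_on_def by blast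
      then have "(?g has_derivative (\<lambda>v. J *v v)) (at (?h z) within ?h ` ?D)"
        by (rule has_derivative_subset) (rule hD)
      moreover have "(?h has_derivative (\<lambda>z. z *s u)) (at z within ?D)"
        using has_derivative_add[OF has_derivative_const bounded_linear_imp_has_derivative[OF lin]]
        by simp
      ultimately have "((\<lambda>z. ?g (?h z)) has_derivative (\<lambda>t. J *v (t *s u))) (at z within ?D)"
        by (rule has_derivative_in_compose[rotated])
      then have "((\<lambda>z. ?g (?h z) $ i) has_derivative (\<lambda>t. (J *v (t *s u)) $ i)) (at z within ?D)"
        by (rule bounded_linear.has_derivative[OF bounded_linear_vec_nth])
      moreover have "(\<lambda>t. (J *v (t *s u)) $ i) = (*) ((J *v u) $ i)"
        by (simp add: vector_scalar_commute fun_eq_iff mult.commute)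
      ultimately have "((\<lambda>z. ?g (?h z) $ i) has_field_derivative (J *v u) $ i) (at z within ?D)"
        by (simp add: has_field_derivative_def)
      then show "(\<lambda>z. ?g (?h z) $ i) field_differentiable at z within ?D"
        by (auto simp: field_differentiable_def)
    qed
    then show "(\<lambda>z. \<psi> (inv_into U \<phi> (?h z)) $ i) holomorphic_on ?D"
      by (simp add: comp_def)
  qed
qed

text \<open>
  Both the continuity of the Kobayashi distance and the existence of chains rest on this. If the
  chart contains a ball of radius \<open>R\<close> in \<open>E\<close> around \<open>\<phi>
  x\<close>, then a point with chart coordinate within \<open>t * R\<close> lies on an affine disc
  centred at \<open>x\<close>, at the parameter \<open>t\<close> whatever the point is.
\<close>

lemma nearby_points_on_small_disc:
  assumes man: "complex_manifold E X \<A>" and x: "x \<in> topspace X" and e: "e > 0"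
  obtains W where "openin X W" "x \<in> W"
    "\<And>y. y \<in> W \<Longrightarrow> \<exists>f a b. holomorphic_disc X \<A> f \<and> a \<in> ball 0 1 \<and> b \<in> ball 0 1 \<and>
        f a = x \<and> f b = y \<and> poincare_dist a b < e"
proof -
  obtain U \<phi> R where U: "(U, \<phi>) \<in> \<A>" "is_chart E X U \<phi>" "x \<in> U" "R > 0"
    "cball (\<phi> x) R \<inter> E \<subseteq> \<phi> ` U" "\<phi> ` U \<subseteq> E"
    using manifold_chart_ball[OF man x] by metis
  have E: "vec.subspace E"
    using man by (simp add: complex_manifold_def)
  \<comment> \<open>The parameter at Poincare distance \<open>e / 2\<close> from the origin.\<close>
  define t where "t = tanh (e / 2)"
  have t: "0 < t" "t < 1" "artanh t < e"
    using e by (auto simp: t_def artanh_tanh_real tanh_real_lt_1)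
  let ?W = "{y \<in> U. \<phi> y \<in> ball (\<phi> x) (t * R)}"
  show ?thesis
  proof
    show "openin X ?W"
      using chart_preimage_open[OF U(2)] by blast
    show "x \<in> ?W"
      using U t by simp
    fix y assume y: "y \<in> ?W"
    define u where "u = of_real (1 / t) *s (\<phi> y - \<phi> x)"
    let ?f = "\<lambda>z. inv_into U \<phi> (\<phi> x + z *s u)"
    have "norm u = norm (\<phi> y - \<phi> x) / t"
      using t by (simp only: u_def norm_vector_scalar_mult) (simp add: norm_divide)
    also have "\<dots> \<le> R"
      using y t by (simp add: dist_norm norm_minus_commute divide_le_eq mult.commute)
    finally have u: "norm u \<le> R" .
    have xy: "\<phi> x \<in> E" "\<phi> y \<in> E"
      using U y by auto
    then have uE: "u \<in> E"
      unfolding u_def using E by (intro vec.subspace_scale vec.subspace_diff)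
    have "\<phi> x + z *s u \<in> \<phi> ` U" if z: "z \<in> ball 0 1" for z
    proof -
      have "cmod z * norm u \<le> 1 * R"
        using z u by (intro mult_mono) auto
      then have "\<phi> x + z *s u \<in> cball (\<phi> x) R"
        by (simp add: dist_norm norm_vector_scalar_mult)
      moreover have "\<phi> x + z *s u \<in> E"
        using E xy uE by (intro vec.subspace_add vec.subspace_scale)
      ultimately show ?thesis
        using U(5) by blast
    qed
    then have "holomorphic_disc X \<A> ?f"
      by (rule linear_disc_in_chart[OF man U(1)])
    moreover have "?f 0 = x"
      using chart_inverse(1)[OF U(2)] U(3) by simp
    moreover have "?f (of_real t) = y"
    proof -
      have "of_real t *s u = \<phi> y - \<phi> x"
        using t by (simp add: u_def flip: of_real_mult)
      then show ?thesis
        using chart_inverse(1)[OF U(2)] y by simp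
    qed
    moreover have "poincare_dist 0 (of_real t) < e"
      using t by (simp add: poincare_dist_def)
    ultimately show "\<exists>f a b. holomorphic_disc X \<A> f \<and> a \<in> ball 0 1 \<and> b \<in> ball 0 1 \<and>
        f a = x \<and> f b = y \<and> poincare_dist a b < e"
      using t by (intro exI[of _ ?f] exI[of _ 0] exI[of _ "of_real t"]) auto
  qed
qed


section \<open>Chains of discs and the Kobayashi distance\<close>

definition disc_chain ::
    "'a topology \<Rightarrow> ('a set \<times> ('a \<Rightarrow> complex^'n)) set \<Rightarrow> nat \<Rightarrow> (nat \<Rightarrow> 'a) \<Rightarrow>
     (nat \<Rightarrow> complex \<Rightarrow> 'a) \<Rightarrow> (nat \<Rightarrow> complex) \<Rightarrow> (nat \<Rightarrow> complex) \<Rightarrow> bool" where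
  "disc_chain X \<A> m p f a b \<longleftrightarrow>
     (\<forall>j<m. holomorphic_disc X \<A> (f j) \<and> a j \<in> ball 0 1 \<and> b j \<in> ball 0 1 \<and>
            f j (a j) = p j \<and> f j (b j) = p (Suc j))"

definition chain_lengths ::
    "'a topology \<Rightarrow> ('a set \<times> ('a \<Rightarrow> complex^'n)) set \<Rightarrow> 'a \<Rightarrow> 'a \<Rightarrow> real set" where
  "chain_lengths X \<A> x y =
     {(\<Sum>j<m. poincare_dist (a j) (b j)) | m p f a b. p 0 = x \<and> p m = y \<and> disc_chain X \<A> m p f a b}"

lemma kobayashi_dist_eq_Inf:
  "x \<in> topspace X \<Longrightarrow> y \<in> topspace X \<Longrightarrow> kobayashi_dist X \<A> x y = Inf (chain_lengths X \<A> x y)"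
  by (simp add: kobayashi_dist_def chain_lengths_def disc_chain_def)

lemma chain_lengths_nonneg:
  assumes "L \<in> chain_lengths X \<A> x y"
  shows "L \<ge> 0"
proof -
  obtain m p f a b where L: "L = (\<Sum>j<m. poincare_dist (a j) (b j))" and "disc_chain X \<A> m p f a b"
    using assms unfolding chain_lengths_def by blast
  then show ?thesis
    unfolding L disc_chain_def by (intro sum_nonneg poincare_dist_nonneg) auto
qed

lemma holomorphic_disc_in_topspace:
  "holomorphic_disc X \<A> f \<Longrightarrow> z \<in> ball 0 1 \<Longrightarrow> f z \<in> topspace X"
  unfolding holomorphic_disc_def continuous_map_def by auto

lemma holomorphic_disc_contracting:
  assumes f: "holomorphic_disc X \<A> f" and ab: "a \<in> ball 0 1" "b \<in> ball 0 1"
  shows "kobayashi_dist X \<A> (f a) (f b) \<le> poincare_dist a b"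
proof -
  have "disc_chain X \<A> 1 (\<lambda>j. if j = 0 then f a else f b) (\<lambda>_. f) (\<lambda>_. a) (\<lambda>_. b)"
    using assms by (simp add: disc_chain_def)
  then have "(\<Sum>j<(1::nat). poincare_dist a b) \<in> chain_lengths X \<A> (f a) (f b)"
    unfolding chain_lengths_def
    by (intro CollectI exI[of _ 1] exI[of _ "\<lambda>j. if j = 0 then f a else f b"] exI[of _ "\<lambda>_. f"]
        exI[of _ "\<lambda>_. a"] exI[of _ "\<lambda>_. b"]) simp
  then have "Inf (chain_lengths X \<A> (f a) (f b)) \<le> poincare_dist a b"
    by (intro cInf_lower bdd_belowI[of _ 0]) (auto intro: chain_lengths_nonneg)
  then show ?thesis
    using kobayashi_dist_eq_Inf holomorphic_disc_in_topspace f ab by metis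
qed

text \<open>
  Replace each link of the chain by the image under its disc of a Poincare geodesic. The union of
  these arcs is connected, and cutting the chain at a point of an arc gives a chain up to that point
  and a chain from it onwards, whose lengths add up to the length of the whole chain, because
  distances along a geodesic are additive.
\<close>

lemma connected_trace_of_chain:
  assumes K: "Metric_space (topspace X) (kobayashi_dist X \<A>)"
    and p0: "p 0 \<in> topspace X" and chain: "disc_chain X \<A> m p f a b"
  shows "\<exists>S. connectedin X S \<and> p 0 \<in> S \<and> p m \<in> S \<and>
           (\<forall>z\<in>S. kobayashi_dist X \<A> (p 0) z + kobayashi_dist X \<A> z (p m)
                   \<le> (\<Sum>j<m. poincare_dist (a j) (b j)))"
  using chain
proof (induction m)
  case 0
  interpret Metric_space "topspace X" "kobayashi_dist X \<A>"
    by (rule K)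
  show ?case
    using p0 by (intro exI[of _ "{p 0}"]) simp
next
  case (Suc m)
  interpret Metric_space "topspace X" "kobayashi_dist X \<A>"
    by (rule K)
  let ?k = "kobayashi_dist X \<A>" and ?L = "\<Sum>j<m. poincare_dist (a j) (b j)"
  have "disc_chain X \<A> m p f a b"
    using Suc.prems by (simp add: disc_chain_def)
  then obtain S where S: "connectedin X S" "p 0 \<in> S" "p m \<in> S"
    and SL: "\<And>z. z \<in> S \<Longrightarrow> ?k (p 0) z + ?k z (p m) \<le> ?L"
    using Suc.IH by blast
  have f: "holomorphic_disc X \<A> (f m)" and ab: "a m \<in> ball 0 1" "b m \<in> ball 0 1"
    and fab: "f m (a m) = p m" "f m (b m) = p (Suc m)"
    using Suc.prems by (auto simp: disc_chain_def)
  obtain \<gamma> :: "real \<Rightarrow> complex" where \<gamma>: "continuous_on {0..1} \<gamma>" "\<gamma> ` {0..1} \<subseteq> ball 0 1"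
    "\<gamma> 0 = a m" "\<gamma> 1 = b m"
    and add: "\<And>t. t \<in> {0..1} \<Longrightarrow>
        poincare_dist (a m) (\<gamma> t) + poincare_dist (\<gamma> t) (b m) = poincare_dist (a m) (b m)"
    using poincare_geodesic[OF ab] by metis
  let ?T = "f m ` \<gamma> ` {0..1}"
  have "connected (\<gamma> ` {0..1})"
    by (rule connected_continuous_image[OF \<gamma>(1)]) simp
  then have "connectedin (top_of_set (ball 0 1)) (\<gamma> ` {0..1})"
    using \<gamma>(2) by (simp add: connectedin_subtopology connectedin_iff_connected)
  then have T: "connectedin X ?T"
    by (rule connectedin_continuous_map_image[rotated]) (use f in \<open>simp add: holomorphic_disc_def\<close>)
  have "\<gamma> 0 \<in> \<gamma> ` {0..1}" "\<gamma> 1 \<in> \<gamma> ` {0..1}"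
    by auto
  then have pT: "p m \<in> ?T" "p (Suc m) \<in> ?T"
    using fab \<gamma>(3,4) by (metis imageI)+
  have top: "z \<in> topspace X" if "z \<in> S \<union> ?T" for z
    using that connectedin_subset_topspace S(1) T by blast
  have step: "?k (p m) (p (Suc m)) \<le> poincare_dist (a m) (b m)"
    using holomorphic_disc_contracting[OF f ab] fab by simp
  have bound: "?k (p 0) z + ?k z (p (Suc m)) \<le> ?L + poincare_dist (a m) (b m)" if "z \<in> S \<union> ?T" for z
    using that
  proof
    assume z: "z \<in> S"
    have "?k z (p (Suc m)) \<le> ?k z (p m) + ?k (p m) (p (Suc m))"
      using z S pT by (intro triangle top) auto
    then show ?thesis
      using SL[OF z] step by linarith
  next
    assume z: "z \<in> ?T"
    then obtain t where t: "t \<in> {0..1}" "z = f m (\<gamma> t)"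
      by blast
    then have "\<gamma> t \<in> ball 0 1"
      using \<gamma>(2) by blast
    then have "?k (p m) z \<le> poincare_dist (a m) (\<gamma> t)" "?k z (p (Suc m)) \<le> poincare_dist (\<gamma> t) (b m)"
      using holomorphic_disc_contracting[OF f] ab fab t(2) by metis+
    moreover have "?k (p 0) z \<le> ?k (p 0) (p m) + ?k (p m) z"
      using z S by (intro triangle top) auto
    moreover have "?k (p 0) (p m) \<le> ?L"
      using SL[OF S(3)] nonneg[of "p m" "p m"] by linarith
    ultimately show ?thesis
      using add[OF t(1)] by linarith
  qed
  show ?case
  proof (intro exI[of _ "S \<union> ?T"] conjI ballI)
    show "connectedin X (S \<union> ?T)"
      using S T pT by (intro connectedin_Un) blast+
    show "p 0 \<in> S \<union> ?T" "p (Suc m) \<in> S \<union> ?T"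
      using S pT by blast+
    show "?k (p 0) z + ?k z (p (Suc m)) \<le> (\<Sum>j<Suc m. poincare_dist (a j) (b j))"
      if "z \<in> S \<union> ?T" for z
      using bound[OF that] by simp
  qed
qed

lemma extend_disc_chain:
  assumes "chain_lengths X \<A> x y \<noteq> {}"
    and disc: "holomorphic_disc X \<A> g" "c \<in> ball 0 1" "c' \<in> ball 0 1" "g c = y" "g c' = z"
  shows "chain_lengths X \<A> x z \<noteq> {}"
proof -
  obtain m p f a b where p: "p 0 = x" "p m = y" and chain: "disc_chain X \<A> m p f a b"
    using assms(1) unfolding chain_lengths_def by blast
  let ?p = "p(Suc m := z)" and ?f = "f(m := g)" and ?a = "a(m := c)" and ?b = "b(m := c')"
  have "disc_chain X \<A> (Suc m) ?p ?f ?a ?b"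
    using chain disc p by (auto simp: disc_chain_def less_Suc_eq)
  moreover have "?p 0 = x" "?p (Suc m) = z"
    using p by auto
  ultimately show ?thesis
    unfolding chain_lengths_def by blast
qed

text \<open>
  The set of points reached from \<open>x\<close> is open and closed, because neighbouring points
  are joined by one disc, which can be traversed in either direction. Without a chain the infimum
  defining the distance would be that of the empty set and would carry no information.
\<close>

lemma disc_chains_exist:
  assumes man: "complex_manifold E X \<A>" and conn: "connected_space X"
    and x: "x \<in> topspace X" and y: "y \<in> topspace X"
  shows "chain_lengths X \<A> x y \<noteq> {}"
proof -
  define R where "R = {y \<in> topspace X. chain_lengths X \<A> x y \<noteq> {}}"
  have nbhd: "\<exists>W. openin X W \<and> y \<in> W \<and> (\<forall>z\<in>W. z \<in> R \<longleftrightarrow> y \<in> R)" if y: "y \<in> topspace X" for y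
  proof -
    obtain W where W: "openin X W" "y \<in> W"
      and disc: "\<And>z. z \<in> W \<Longrightarrow> \<exists>f a b. holomorphic_disc X \<A> f \<and> a \<in> ball 0 1 \<and> b \<in> ball 0 1 \<and>
          f a = y \<and> f b = z \<and> poincare_dist a b < 1"
      using nearby_points_on_small_disc[OF man y zero_less_one] by metis
    have "z \<in> R \<longleftrightarrow> y \<in> R" if z: "z \<in> W" for z
    proof -
      have "z \<in> topspace X"
        using z W(1) openin_subset by blast
      moreover obtain f a b where f: "holomorphic_disc X \<A> f" "a \<in> ball 0 1" "b \<in> ball 0 1"
          "f a = y" "f b = z"
        using disc[OF z] by blast
      then have "chain_lengths X \<A> x z \<noteq> {} \<longleftrightarrow> chain_lengths X \<A> x y \<noteq> {}"
        using extend_disc_chain[of X \<A> x y f a b z] extend_disc_chain[of X \<A> x z f b a y] by auto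
      ultimately show ?thesis
        unfolding R_def using y by simp
    qed
    then show ?thesis
      using W by blast
  qed
  have "\<exists>W. openin X W \<and> y \<in> W \<and> W \<subseteq> R" if "y \<in> R" for y
    using nbhd[of y] that R_def by blast
  then have "openin X R"
    using openin_subopen[of X R] by meson
  moreover have "\<exists>W. openin X W \<and> y \<in> W \<and> W \<subseteq> topspace X - R" if y: "y \<in> topspace X - R" for y
  proof -
    obtain W where W: "openin X W" "y \<in> W" "\<forall>z\<in>W. z \<in> R \<longleftrightarrow> y \<in> R"
      using nbhd[of y] y by blast
    moreover have "W \<subseteq> topspace X"
      using W(1) by (rule openin_subset)
    ultimately show ?thesis
      using y by blast
  qed
  then have "openin X (topspace X - R)"
    using openin_subopen[of X "topspace X - R"] by meson
  moreover have "R \<subseteq> topspace X"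
    by (simp add: R_def)
  ultimately have "R = {} \<or> R = topspace X"
    using conn unfolding connected_space_clopen_in closedin_def by meson
  moreover have "x \<in> R"
  proof -
    have "0 \<in> chain_lengths X \<A> x x"
      unfolding chain_lengths_def
      by (intro CollectI exI[of _ 0] exI[of _ "\<lambda>_. x"]) (simp add: disc_chain_def)
    then show ?thesis
      unfolding R_def using x by blast
  qed
  ultimately show ?thesis
    using y unfolding R_def by blast
qed

text \<open>
  The Kobayashi distance is approximately geodesic by construction: take the trace of a chain whose
  length almost attains the infimum.
\<close>

lemma kobayashi_near_geodesic:
  assumes man: "complex_manifold E X \<A>" and conn: "connected_space X"
    and K: "Metric_space (topspace X) (kobayashi_dist X \<A>)"
    and x: "x \<in> topspace X" and y: "y \<in> topspace X" and e: "e > 0"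
  shows "\<exists>S. connectedin X S \<and> x \<in> S \<and> y \<in> S \<and>
           (\<forall>z\<in>S. kobayashi_dist X \<A> x z + kobayashi_dist X \<A> z y < kobayashi_dist X \<A> x y + e)"
proof -
  have "Inf (chain_lengths X \<A> x y) < kobayashi_dist X \<A> x y + e"
    using kobayashi_dist_eq_Inf[OF x y, of \<A>] e by simp
  then obtain L where L: "L \<in> chain_lengths X \<A> x y" "L < kobayashi_dist X \<A> x y + e"
    using cInf_lessD[OF disc_chains_exist[OF man conn x y]] by blast
  then obtain m p f a b where p: "p 0 = x" "p m = y" "disc_chain X \<A> m p f a b"
      "L = (\<Sum>j<m. poincare_dist (a j) (b j))"
    unfolding chain_lengths_def by blast
  then obtain S where "connectedin X S" "x \<in> S" "y \<in> S"
    "\<And>z. z \<in> S \<Longrightarrow> kobayashi_dist X \<A> x z + kobayashi_dist X \<A> z y \<le> L"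
    using connected_trace_of_chain[OF K, of p m f a b] x by blast
  then show ?thesis
    using L(2) by (meson le_less_trans)
qed

lemma continuous_map_kobayashi_dist:
  assumes man: "complex_manifold E X \<A>"
    and K: "Metric_space (topspace X) (kobayashi_dist X \<A>)" and x: "x \<in> topspace X"
  shows "continuous_map X euclideanreal (kobayashi_dist X \<A> x)"
  unfolding continuous_map
proof (intro conjI allI impI)
  interpret Metric_space "topspace X" "kobayashi_dist X \<A>"
    by (rule K)
  let ?k = "kobayashi_dist X \<A>"
  fix U :: "real set" assume "openin euclideanreal U"
  then have U: "open U"
    by simp
  have "\<exists>W. openin X W \<and> y \<in> W \<and> W \<subseteq> {y \<in> topspace X. ?k x y \<in> U}"
    if y: "y \<in> {y \<in> topspace X. ?k x y \<in> U}" for y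
  proof -
    obtain e where e: "e > 0" "ball (?k x y) e \<subseteq> U"
      using y U open_contains_ball by blast
    have yX: "y \<in> topspace X"
      using y by simp
    obtain W where W: "openin X W" "y \<in> W"
      and disc: "\<And>z. z \<in> W \<Longrightarrow> \<exists>f a b. holomorphic_disc X \<A> f \<and> a \<in> ball 0 1 \<and> b \<in> ball 0 1 \<and>
          f a = y \<and> f b = z \<and> poincare_dist a b < e"
      using nearby_points_on_small_disc[OF man yX e(1)] by metis
    have "W \<subseteq> {y \<in> topspace X. ?k x y \<in> U}"
    proof
      fix z assume z: "z \<in> W"
      then have zX: "z \<in> topspace X"
        using W(1) openin_subset by blast
      have "?k y z < e"
      proof -
        obtain f a b where "holomorphic_disc X \<A> f" "a \<in> ball 0 1" "b \<in> ball 0 1"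
            "f a = y" "f b = z" "poincare_dist a b < e"
          using disc[OF z] by blast
        then show ?thesis
          using holomorphic_disc_contracting[of X \<A> f a b] by simp
      qed
      then have "?k x z \<in> ball (?k x y) e"
        using mdist_reverse_triangle[OF yX x zX] by (simp add: dist_real_def commute)
      then show "z \<in> {y \<in> topspace X. ?k x y \<in> U}"
        using e zX by blast
    qed
    then show ?thesis
      using W by blast
  qed
  then show "openin X {y \<in> topspace X. ?k x y \<in> U}"
    by (subst openin_subopen) blast
qed auto

text \<open>
  Barth's argument makes the manifold topology the metric topology of the Kobayashi distance, after
  which the statement about approximately geodesic spaces applies.
\<close>

theorem theorem1p2:
  fixes E :: "(complex^'n) set"
    and X :: "'a topology"
    and \<A> :: "('a set \<times> ('a \<Rightarrow> complex^'n)) set"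
  assumes "complex_manifold E X \<A>"
    and "connected_space X"
    and "kobayashi_hyperbolic X \<A>"
  shows "is_compactification X
           (metric_compactification (topspace X) (kobayashi_dist X \<A>))
           (metric_embedding (topspace X) (kobayashi_dist X \<A>))"
proof -
  let ?k = "kobayashi_dist X \<A>"
  have K: "Metric_space (topspace X) ?k"
    using assms(3) by (simp add: kobayashi_hyperbolic_def)
  interpret Metric_space "topspace X" ?k
    by (rule K)
  have X: "Hausdorff_space X" "second_countable X" "locally_compact_space X"
    using assms(1) locally_compact_complex_manifold by (auto simp: complex_manifold_def)
  have near: "\<exists>S. connectedin X S \<and> x \<in> S \<and> y \<in> S \<and> (\<forall>z\<in>S. ?k x z + ?k z y < ?k x y + e)"
    if "x \<in> topspace X" "y \<in> topspace X" "e > 0" for x y e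
    by (rule kobayashi_near_geodesic[OF assms(1,2) K that])
  have top: "mtopology = X"
  proof (rule near_geodesics_determine_topology)
    show "continuous_map X euclideanreal (?k x)" if "x \<in> topspace X" for x
      by (rule continuous_map_kobayashi_dist[OF assms(1) K that])
    fix x y and e :: real assume xy: "x \<in> topspace X" "y \<in> topspace X" "e > 0"
    obtain S where S: "connectedin X S" "x \<in> S" "y \<in> S" "\<forall>z\<in>S. ?k x z + ?k z y < ?k x y + e"
      using near[OF xy] by blast
    have "?k x z < ?k x y + e" if "z \<in> S" for z
      using bspec[OF S(4) that] nonneg[of z y] by linarith
    then show "\<exists>S. connectedin X S \<and> x \<in> S \<and> y \<in> S \<and> (\<forall>z\<in>S. ?k x z < ?k x y + e)"
      using S by blast
  qed (use X in auto)
  have "approximately_geodesic_space (topspace X) ?k"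
    by unfold_locales (use top X near second_countable_imp_separable_space in auto)
  from approximately_geodesic_space.metric_compactification_is_compactification[OF this]
  show ?thesis
    by (simp only: top)
qed

end
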